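(* For $m\ge1$, $n\ge0$, $k\ge0$, $$S^o_{\mathrm{CR}}[m,n,k]=\sum_{\omega\in S^o_{\mathrm{CR}}([n^m],k)}q^{\operatorname{inv}\omega},$$ where $S^o_{\mathrm{CR}}[m,n,k]=[km]!_m\,S[m,n,k]$.
   Context: $[j]=1+q+\dots+q^{j-1}$; $[km]!_m=[m][2m]\cdots[km]$ (empty product $1$ for $k=0$). Let $\zeta_m=e^{2\pi i/m}$, $i^c=\zeta_m^c\mathbf e_i$ for $i\in[n]$ (colors mod $m$), $[n^m]=\{0\}\cup\{i^c:i\in[n],0\le c<m\}$, $zS=\{zs:s\in S\}$. A colored set partition of type $(m,n)$ is a set partition of $[n^m]$ into blocks $S_0,\dots,S_{km}$ with (i) $0\in S_0$ and if some $i^c\in S_0$ then all $i^d\in S_0$; (ii) for each $0\le l<k$, $S_{lm+1},\dots,S_{(l+1)m}$ are distinct and of the form $S,\zeta_mS,\dots,\zeta_m^{m-1}S$. For nonempty $S$, $\operatorname{minb}S=0$ if $0\in S$, else the least base in $S$. Standard form: blocks labeled so that (ii) holds, $s_i=\operatorname{minb}S_i$ satisfy $0=s_0<s_m<\dots<s_{km}$, and $s_j^{\,r}\in S_j$ for $j\in[km]$ with $r=j\bmod m$. An inversion of a partition in standard form is a pair $(i^0,S_l)$ with $i^0\in S_j$, $j<l$, $i\ge s_l$. $S[m,n,k]=\sum q^{\operatorname{inv}\sigma}$ over type $(m,n)$ colored set partitions with $km+1$ blocks. A CR-ordered set partition is a sequence $\omega=(S_0/S_1/\dots/S_{km})$ whose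 blocks form a type $(m,n)$ colored set partition with zero block $S_0$ (no ordering inside $S_0$) and such that $S_{i+1}=\zeta_mS_i$ for all $i\in[km-1]$ not divisible by $m$; $S^o_{\mathrm{CR}}([n^m],k)$ is the set of these with $km+1$ blocks. An inversion of $\omega$ is a pair $(i^0,S_l)$ with $i^0\in S_j$, $j<l$, and $i\ge\operatorname{minb}S_l$. *)

theory Defs
  imports Complex_Main "HOL-Library.Disjoint_Sets" "HOL-Computational_Algebra.Polynomial"
begin

text \<open>Vectors are functions from coordinates to complex numbers. Only the coordinates
  \<open>1, \<dots>, n\<close> are ever nonzero on the ground set \<open>[n\<^sup>m]\<close>, so the dimension does not have
  to appear in the type.\<close>

type_synonym cvec = "nat \<Rightarrow> complex"

definition zero_vec :: cvec where
  "zero_vec = (\<lambda>_. 0)"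

definition unit_vec :: "nat \<Rightarrow> cvec" where
  "unit_vec i = (\<lambda>j. if j = i then 1 else 0)"

definition smult_vec :: "complex \<Rightarrow> cvec \<Rightarrow> cvec" where
  "smult_vec z v = (\<lambda>j. z * v j)"

definition smult_set :: "complex \<Rightarrow> cvec set \<Rightarrow> cvec set" where
  "smult_set z S = smult_vec z ` S"

definition zeta :: "nat \<Rightarrow> complex" where
  "zeta m = exp (2 * of_real pi * \<i> / of_nat m)"

text \<open>\<open>colored m i c\<close> is the element \<open>i\<^sup>c\<close> with base \<open>i\<close> and color \<open>c\<close>.\<close>

definition colored :: "nat \<Rightarrow> nat \<Rightarrow> nat \<Rightarrow> cvec" where
  "colored m i c = smult_vec (zeta m ^ c) (unit_vec i)"

definition ground :: "nat \<Rightarrow> nat \<Rightarrow> cvec set" where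
  "ground m n = {zero_vec} \<union> {colored m i c | i c. i \<in> {1..n} \<and> c < m}"

text \<open>A labeling \<open>S\<^sub>0, \<dots>, S\<^sub>k\<^sub>m\<close> of the blocks is a list. In the last clause the blocks
  \<open>S\<^sub>l\<^sub>m\<^sub>+\<^sub>1, \<dots>, S\<^sub>(\<^sub>l\<^sub>+\<^sub>1\<^sub>)\<^sub>m\<close> are the translates of some \<open>S\<close>, in an arbitrary order;
  that they are pairwise distinct is part of \<open>distinct B\<close>.\<close>

definition colored_labeling :: "nat \<Rightarrow> nat \<Rightarrow> nat \<Rightarrow> cvec set list \<Rightarrow> bool" where
  "colored_labeling m n k B \<longleftrightarrow>
     length B = k * m + 1 \<and> distinct B \<and> partition_on (ground m n) (set B) \<and>
     zero_vec \<in> B ! 0 \<and>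
     (\<forall>i\<in>{1..n}. (\<exists>c<m. colored m i c \<in> B ! 0) \<longrightarrow> (\<forall>d<m. colored m i d \<in> B ! 0)) \<and>
     (\<forall>l<k. \<exists>S. (\<lambda>j. B ! j) ` {l * m + 1..(l + 1) * m} =
                  (\<lambda>c. smult_set (zeta m ^ c) S) ` {..<m})"

definition colored_partitions :: "nat \<Rightarrow> nat \<Rightarrow> nat \<Rightarrow> cvec set set set" where
  "colored_partitions m n k = {set B | B. colored_labeling m n k B}"

definition minb :: "nat \<Rightarrow> cvec set \<Rightarrow> nat" where
  "minb m S = (if zero_vec \<in> S then 0 else (LEAST i. \<exists>c<m. colored m i c \<in> S))"

definition standard_form :: "nat \<Rightarrow> nat \<Rightarrow> nat \<Rightarrow> cvec set list \<Rightarrow> bool" where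
  "standard_form m n k B \<longleftrightarrow>
     colored_labeling m n k B \<and>
     minb m (B ! 0) = 0 \<and>
     (\<forall>l<k. minb m (B ! (l * m)) < minb m (B ! ((l + 1) * m))) \<and>
     (\<forall>j\<in>{1..k * m}. colored m (minb m (B ! j)) (j mod m) \<in> B ! j)"

definition inversions :: "nat \<Rightarrow> cvec set list \<Rightarrow> (cvec \<times> cvec set) set" where
  "inversions m B =
     {(colored m i 0, B ! l) | i j l.
        j < l \<and> l < length B \<and> colored m i 0 \<in> B ! j \<and> i \<ge> minb m (B ! l)}"

definition inv_list :: "nat \<Rightarrow> cvec set list \<Rightarrow> nat" where
  "inv_list m B = card (inversions m B)"

text \<open>For \<open>m \<ge> 1\<close> every colored set partition has exactly one standard form.\<close>

definition inv_partition :: "nat \<Rightarrow> nat \<Rightarrow> nat \<Rightarrow> cvec set set \<Rightarrow> nat" where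
  "inv_partition m n k \<sigma> = inv_list m (THE B. standard_form m n k B \<and> set B = \<sigma>)"

definition q_var :: "int poly" where
  "q_var = [:0, 1:]"

definition q_int :: "nat \<Rightarrow> int poly" where
  "q_int j = (\<Sum>i<j. q_var ^ i)"

text \<open>\<open>q_fact m k\<close> is \<open>[km]!\<^sub>m = [m][2m]\<cdots>[km]\<close>.\<close>

definition q_fact :: "nat \<Rightarrow> nat \<Rightarrow> int poly" where
  "q_fact m k = (\<Prod>i=1..k. q_int (i * m))"

definition q_stirling :: "nat \<Rightarrow> nat \<Rightarrow> nat \<Rightarrow> int poly" where
  "q_stirling m n k = (\<Sum>\<sigma>\<in>colored_partitions m n k. q_var ^ inv_partition m n k \<sigma>)"

definition CR_ordered :: "nat \<Rightarrow> nat \<Rightarrow> nat \<Rightarrow> cvec set list set" where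
  "CR_ordered m n k =
     {\<omega>. length \<omega> = k * m + 1 \<and> distinct \<omega> \<and> set \<omega> \<in> colored_partitions m n k \<and>
         zero_vec \<in> \<omega> ! 0 \<and>
         (\<forall>i\<in>{1..<k * m}. \<not> m dvd i \<longrightarrow> \<omega> ! (i + 1) = smult_set (zeta m) (\<omega> ! i))}"

definition q_stirling_CR :: "nat \<Rightarrow> nat \<Rightarrow> nat \<Rightarrow> int poly" where
  "q_stirling_CR m n k = q_fact m k * q_stirling m n k"

end

theory Submission
  imports Defs "HOL-Analysis.Complex_Transcendental"
begin

text \<open>A CR-ordered partition is determined by the positions \<open>f i\<close> of the blocks containing \<open>i\<^sup>0\<close>:
  within a group of \<open>m\<close> consecutive blocks, the element \<open>i\<^sup>c\<close> lies \<open>c\<close> steps (cyclically) after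
  \<open>i\<^sup>0\<close>. So CR-ordered partitions are words \<open>f\<close> on \<open>{1..n}\<close> with values in \<open>{0..k m}\<close> that meet
  every group, and standard forms are the words in which groups appear for the first time in
  increasing order, each at its last position. Removing the largest base \<open>n + 1\<close> gives
  \<open>W(n+1, k) = [k m + 1] W(n, k) + [k m] W(n, k-1)\<close> for the inversion generating functions of all words
  and \<open>V(n+1, k) = [k m + 1] V(n, k) + V(n, k-1)\<close> for those of the standard ones: a base alone in its
  group can sit at any of the \<open>k m\<close> nonzero positions \<open>p\<close>, creating \<open>k m - p\<close> inversions, but in a
  standard word only at \<open>p = k m\<close>. Hence \<open>W = [k m]!\<^sub>m V\<close>. The identity does not hold partition by partition:
  for \<open>m = n = 2\<close>, \<open>k = 1\<close>, the two orderings of a partition can contribute \<open>1 + q\<^sup>2\<close>.\<close>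

section \<open>Words and their recurrences\<close>

text \<open>The group of the block at position \<open>j\<close>: group \<open>0\<close> is the zero block alone, group \<open>l + 1\<close> is
  \<open>{l m + 1..(l + 1) m}\<close>.\<close>

definition grp :: "nat \<Rightarrow> nat \<Rightarrow> nat" where
  "grp m j = (j + m - 1) div m"

text \<open>Words vanish outside \<open>{1..n}\<close>, so that restriction and extension are plain function updates.\<close>

definition words :: "nat \<Rightarrow> nat \<Rightarrow> nat \<Rightarrow> (nat \<Rightarrow> nat) set" where
  "words m n k =
     {f. (\<forall>i. i \<notin> {1..n} \<longrightarrow> f i = 0) \<and> (\<forall>i. f i \<le> k * m) \<and> {1..k} \<subseteq> range (grp m \<circ> f)}"

text \<open>The condition under which base \<open>i\<close> may open a new group in a standard form.
  There position \<open>j\<close> holds the minimal base of its group in color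
  \<open>j mod m\<close>, so the color-0 element of that base lies at a multiple of
  \<open>m\<close>, the last position of the group; and groups are opened in increasing
  order.\<close>

definition fresh_ok :: "nat \<Rightarrow> (nat \<Rightarrow> nat) \<Rightarrow> nat \<Rightarrow> bool" where
  "fresh_ok m f i \<longleftrightarrow>
     (f i \<noteq> 0 \<longrightarrow> grp m (f i) \<notin> (grp m \<circ> f) ` {1..<i} \<longrightarrow>
        m dvd f i \<and> {1..<grp m (f i)} \<subseteq> (grp m \<circ> f) ` {1..<i})"

definition std_words :: "nat \<Rightarrow> nat \<Rightarrow> nat \<Rightarrow> (nat \<Rightarrow> nat) set" where
  "std_words m n k = {f \<in> words m n k. \<forall>i\<in>{1..n}. fresh_ok m f i}"

text \<open>The groups met by \<open>{1..i}\<close> are those whose blocks have minimal base at most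
  \<open>i\<close>, so the \<open>i\<close>-th summand counts the inversions whose first component
  is the color-0 element of base \<open>i\<close>.\<close>

definition word_inv :: "nat \<Rightarrow> nat \<Rightarrow> nat \<Rightarrow> (nat \<Rightarrow> nat) \<Rightarrow> nat" where
  "word_inv m n k f =
     (\<Sum>i=1..n. card {j. f i < j \<and> j \<le> k * m \<and> grp m j \<in> (grp m \<circ> f) ` {1..i}})"

text \<open>Makes room for a new group \<open>l + 1\<close> by moving all later groups up.\<close>

definition shift :: "nat \<Rightarrow> nat \<Rightarrow> nat \<Rightarrow> nat" where
  "shift m l x = (if x \<le> l * m then x else x + m)"

section \<open>Arithmetic of groups, residues and \<open>shift\<close>\<close>

context
  fixes m :: nat
  assumes m_pos: "m \<ge> 1"
begin

text \<open>\<open>grp m j\<close> is the ceiling of \<open>j / m\<close>, hence adjoint to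
  multiplication by \<open>m\<close>. Comparisons between groups and positions go through this
  equivalence.\<close>

lemma grp_le_iff: "grp m j \<le> l \<longleftrightarrow> j \<le> l * m"
proof -
  have "grp m j \<le> l \<longleftrightarrow> (j + m - 1) div m < Suc l"
    by (simp add: grp_def less_Suc_eq_le)
  also have "\<dots> \<longleftrightarrow> j + m - 1 < Suc l * m"
    using m_pos by (subst div_less_iff_less_mult) auto
  also have "\<dots> \<longleftrightarrow> j \<le> l * m" using m_pos by auto
  finally show ?thesis .
qed

lemma grp_eq_Suc_iff: "grp m j = Suc l \<longleftrightarrow> l * m < j \<and> j \<le> Suc l * m"
  using grp_le_iff[of j l] grp_le_iff[of j "Suc l"] by linarith

lemma grp_eq_0_iff [simp]: "grp m j = 0 \<longleftrightarrow> j = 0"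
  using grp_le_iff[of j 0] by simp

lemma grp_0 [simp]: "grp m 0 = 0"
  by simp

lemma grp_mult [simp]: "grp m (l * m) = l"
  using m_pos by (cases l) (auto simp: grp_eq_Suc_iff)

lemma grp_add [simp]: "grp m (j + m) = Suc (grp m j)"
proof -
  have "j + m + m - 1 = (j + m - 1) + m" using m_pos by simp
  then show ?thesis unfolding grp_def using m_pos by (simp only: div_add_self2)
qed

lemma grp_mem_iff: "grp m j \<in> {1..k} \<longleftrightarrow> 0 < j \<and> j \<le> k * m"
  using grp_le_iff[of j k] grp_eq_0_iff[of j] unfolding atLeastAtMost_iff by linarith

text \<open>A nonzero group consists of \<open>m\<close> consecutive positions, so two of its
  members that agree modulo \<open>m\<close> differ by a multiple of \<open>m\<close> smaller than
  \<open>m\<close>.\<close>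

lemma grp_mod_unique:
  assumes "grp m j = grp m j'" "j mod m = j' mod m"
  shows "j = j'"
proof (cases "grp m j")
  case 0
  then show ?thesis using assms by auto
next
  case (Suc l)
  then have *: "l * m < j" "j \<le> l * m + m" "l * m < j'" "j' \<le> l * m + m"
    using assms(1) grp_eq_Suc_iff[of j l] grp_eq_Suc_iff[of j' l] by auto
  have "j \<le> j' \<Longrightarrow> m dvd j' - j" "j' \<le> j \<Longrightarrow> m dvd j - j'"
    using assms(2) by (simp_all flip: mod_eq_dvd_iff_nat)
  moreover have "j' - j < m" "j - j' < m" using * by linarith+
  ultimately show ?thesis by (cases "j \<le> j'") (auto dest!: dvd_imp_le)
qed

lemma grp_mod_exists:
  obtains j where "grp m j = Suc l" "j mod m = r mod m"
proof
  \<comment> \<open>\<open>x\<close> represents \<open>r - 1\<close> modulo \<open>m\<close>: it is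
    the offset from \<open>l * m + 1\<close>, the first position of the group.\<close>
  define x where "x = (r + m - 1) mod m"
  have "x < m" using m_pos by (simp add: x_def)
  then show "grp m (l * m + 1 + x) = Suc l" by (simp add: grp_eq_Suc_iff)
  have "(l * m + 1 + x) mod m = (1 + (r + m - 1)) mod m"
    unfolding x_def by (metis add.assoc mod_add_right_eq mod_mult_self3)
  also have "\<dots> = r mod m" using m_pos by simp
  finally show "(l * m + 1 + x) mod m = r mod m" .
qed

lemma grp_shift: "grp m (shift m l x) = (if grp m x \<le> l then grp m x else Suc (grp m x))"
  by (simp add: shift_def grp_le_iff)

lemma grp_shift_eq_iff [simp]: "grp m (shift m l x) = grp m (shift m l y) \<longleftrightarrow> grp m x = grp m y"
  by (auto simp: grp_shift)

lemma shift_less_iff [simp]: "shift m l x < shift m l y \<longleftrightarrow> x < y"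
  by (auto simp: shift_def)

lemma inj_shift: "inj (shift m l)"
  by (intro injI) (metis less_irrefl linorder_neqE_nat shift_less_iff)

lemma grp_shift_neq: "grp m (shift m l x) \<noteq> Suc l"
  by (auto simp: grp_shift)

text \<open>\<open>shift m l\<close> skips exactly group \<open>l + 1\<close>: positions below it
  stay where they are, and positions above it come from \<open>m\<close> places lower.\<close>

lemma shift_surj:
  assumes "grp m y \<noteq> Suc l"
  obtains x where "y = shift m l x"
proof -
  have "y \<le> l * m \<or> y > l * m + m" using assms by (auto simp: grp_eq_Suc_iff)
  then show ?thesis
  proof
    assume "y \<le> l * m" then show ?thesis by (intro that[of y]) (simp add: shift_def)
  next
    assume "y > l * m + m" then show ?thesis by (intro that[of "y - m"]) (simp add: shift_def)
  qed
qed

lemma shift_le_iff: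
  assumes "l \<le> k"
  shows "shift m l x \<le> Suc k * m \<longleftrightarrow> x \<le> k * m"
proof -
  have "l * m \<le> k * m" using assms by simp
  then show ?thesis
    by (cases "x \<le> l * m"; simp only: shift_def if_True if_False mult_Suc; linarith)
qed

section \<open>Words: insertion of the largest base and its effect on inversions\<close>

lemma finite_words: "finite (words m n k)"
proof (rule finite_subset)
  show "words m n k \<subseteq> {f. \<forall>i. (i \<in> {1..n} \<longrightarrow> f i \<in> {..k * m}) \<and> (i \<notin> {1..n} \<longrightarrow> f i = 0)}"
    by (auto simp: words_def)
qed (rule finite_set_of_finite_funs; simp)

lemma words_le: "f \<in> words m n k \<Longrightarrow> f i \<le> k * m"
  by (simp add: words_def)

lemma words_0: "f \<in> words m n k \<Longrightarrow> i \<notin> {1..n} \<Longrightarrow> f i = 0"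
  by (auto simp: words_def)

text \<open>Outside \<open>{1..n}\<close> a word is 0 and lies in group 0, so a nonzero group can
  only be met inside.\<close>

lemma words_hits: "f \<in> words m n k \<Longrightarrow> g \<in> {1..k} \<Longrightarrow> \<exists>i\<in>{1..n}. grp m (f i) = g"
proof -
  assume f: "f \<in> words m n k" and g: "g \<in> {1..k}"
  then have "g \<in> range (grp m \<circ> f)" unfolding words_def by blast
  then obtain i where "grp m (f i) = g" by auto
  moreover from this have "i \<in> {1..n}" using words_0[OF f, of i] g by force
  ultimately show ?thesis by blast
qed

lemma words_update:
  assumes "f \<in> words m n k" "p \<le> k * m"
  shows "f(Suc n := p) \<in> words m (Suc n) k"
proof -
  have "{1..k} \<subseteq> range (grp m \<circ> f(Suc n := p))"
  proof
    fix g assume "g \<in> {1..k}"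
    from words_hits[OF assms(1) this] obtain i where "i \<in> {1..n}" "grp m (f i) = g" by blast
    then have "(grp m \<circ> f(Suc n := p)) i = g" by auto
    then show "g \<in> range (grp m \<circ> f(Suc n := p))" by blast
  qed
  then show ?thesis using assms by (auto simp: words_def)
qed

text \<open>The new group \<open>l + 1\<close> is met by \<open>p\<close>; groups up to
  \<open>l\<close> are met as before, and each later group is met where its predecessor was met by
  \<open>f\<close>.\<close>

lemma words_shift_update:
  assumes "f \<in> words m n k" "p \<le> Suc k * m" "grp m p = Suc l"
  shows "(shift m l \<circ> f)(Suc n := p) \<in> words m (Suc n) (Suc k)"
proof -
  have l: "l \<le> k" using assms grp_le_iff[of p "Suc k"] by simp
  let ?h = "(shift m l \<circ> f)(Suc n := p)"
  have "{1..Suc k} \<subseteq> range (grp m \<circ> ?h)"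
  proof
    fix g assume g: "g \<in> {1..Suc k}"
    consider "g = Suc l" | "g \<le> l" | "g > Suc l" by linarith
    then show "g \<in> range (grp m \<circ> ?h)"
    proof cases
      case 1
      then have "(grp m \<circ> ?h) (Suc n) = g" using assms by simp
      then show ?thesis by blast
    next
      case 2
      with g l have "g \<in> {1..k}" by auto
      from words_hits[OF assms(1) this] obtain i where "i \<in> {1..n}" "grp m (f i) = g" by blast
      then have "(grp m \<circ> ?h) i = g" using 2 by (auto simp: grp_shift)
      then show ?thesis by blast
    next
      case 3
      with g have "g - 1 \<in> {1..k}" by auto
      from words_hits[OF assms(1) this] obtain i where "i \<in> {1..n}" "grp m (f i) = g - 1" by blast
      then have "(grp m \<circ> ?h) i = g" using 3 by (auto simp: grp_shift)
      then show ?thesis by blast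
    qed
  qed
  moreover have "shift m l 0 = 0" by (simp add: shift_def)
  ultimately show ?thesis
    using assms shift_le_iff[OF l] by (auto simp: words_def)
qed

text \<open>All nonzero groups are already met by \<open>f\<close>, so base \<open>n + 1\<close>
  counts every position to the right of \<open>p\<close>. The summand of a smaller base
  \<open>i\<close> depends only on the values at \<open>{1..i}\<close> and does not change.\<close>

lemma word_inv_update:
  assumes "f \<in> words m n k" "p \<le> k * m"
  shows "word_inv m (Suc n) k (f(Suc n := p)) = word_inv m n k f + (k * m - p)"
proof -
  let ?h = "f(Suc n := p)"
  have "{j. p < j \<and> j \<le> k * m \<and> grp m j \<in> (grp m \<circ> ?h) ` {1..Suc n}} = {p<..k * m}"
  proof -
    have "grp m j \<in> (grp m \<circ> ?h) ` {1..Suc n}" if j: "p < j" "j \<le> k * m" for j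
    proof -
      have "grp m j \<in> {1..k}" using j grp_mem_iff by simp
      from words_hits[OF assms(1) this] obtain i where i: "i \<in> {1..n}" "grp m (f i) = grp m j"
        by blast
      then have "(grp m \<circ> ?h) i = grp m j" by auto
      then show ?thesis using i by (metis atLeastAtMost_iff image_eqI le_Suc_eq)
    qed
    then show ?thesis by auto
  qed
  moreover have "card {j. ?h i < j \<and> j \<le> k * m \<and> grp m j \<in> (grp m \<circ> ?h) ` {1..i}} =
        card {j. f i < j \<and> j \<le> k * m \<and> grp m j \<in> (grp m \<circ> f) ` {1..i}}" if "i \<in> {1..n}" for i
  proof -
    have "(grp m \<circ> ?h) ` {1..i} = (grp m \<circ> f) ` {1..i}"
      using that by (intro image_cong) auto
    then show ?thesis using that by auto
  qed
  ultimately show ?thesis by (simp add: word_inv_def)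
qed

text \<open>For a base \<open>i\<close> up to \<open>n\<close> the inserted group is not met by
  \<open>{1..i}\<close> and contributes nothing, so the strictly increasing map
  \<open>shift m l\<close> is a bijection between the counted positions. Base \<open>n + 1\<close>
  counts everything to the right of \<open>p\<close>.\<close>

lemma word_inv_shift_update:
  assumes "f \<in> words m n k" "p \<le> Suc k * m" "grp m p = Suc l"
  shows "word_inv m (Suc n) (Suc k) ((shift m l \<circ> f)(Suc n := p)) =
           word_inv m n k f + (Suc k * m - p)"
proof -
  have l: "l \<le> k" using assms grp_le_iff[of p "Suc k"] by simp
  let ?h = "(shift m l \<circ> f)(Suc n := p)"
  have h: "?h \<in> words m (Suc n) (Suc k)" by (rule words_shift_update[OF assms])
  have "{j. p < j \<and> j \<le> Suc k * m \<and> grp m j \<in> (grp m \<circ> ?h) ` {1..Suc n}} = {p<..Suc k * m}"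
  proof -
    have "grp m j \<in> (grp m \<circ> ?h) ` {1..Suc n}" if j: "p < j" "j \<le> Suc k * m" for j
    proof -
      have "grp m j \<in> {1..Suc k}" unfolding grp_mem_iff using j by simp
      from words_hits[OF h this] show ?thesis by (metis comp_apply image_eqI)
    qed
    then show ?thesis by auto
  qed
  moreover have "card {j. ?h i < j \<and> j \<le> Suc k * m \<and> grp m j \<in> (grp m \<circ> ?h) ` {1..i}} =
        card {j. f i < j \<and> j \<le> k * m \<and> grp m j \<in> (grp m \<circ> f) ` {1..i}}" if i: "i \<in> {1..n}" for i
  proof -
    have im: "(grp m \<circ> ?h) ` {1..i} = (\<lambda>i. grp m (shift m l (f i))) ` {1..i}"
      using i by (intro image_cong) auto
    have hi: "?h i = shift m l (f i)" using i by auto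
    have "{j. ?h i < j \<and> j \<le> Suc k * m \<and> grp m j \<in> (grp m \<circ> ?h) ` {1..i}} =
        shift m l ` {j. f i < j \<and> j \<le> k * m \<and> grp m j \<in> (grp m \<circ> f) ` {1..i}}" (is "?L = ?R")
    proof
      show "?L \<subseteq> ?R"
      proof
        fix y assume y: "y \<in> ?L"
        then obtain i' where "grp m y = grp m (shift m l (f i'))" unfolding im by blast
        \<comment> \<open>A counted position lies in a group met by a smaller base, hence outside
          the inserted group, and has a preimage under \<open>shift m l\<close>.\<close>
        then have "grp m y \<noteq> Suc l" using grp_shift_neq[of l "f i'"] by (simp only: not_False_eq_True)
        then obtain x where "y = shift m l x" by (rule shift_surj)
        with y show "y \<in> ?R" unfolding im hi
          by (auto simp: shift_le_iff[OF l] simp del: mult_Suc intro!: imageI)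
      qed
      show "?R \<subseteq> ?L" unfolding im hi
        by (auto simp: shift_le_iff[OF l] simp del: mult_Suc)
    qed
    then show ?thesis by (simp add: card_image inj_on_subset[OF inj_shift])
  qed
  ultimately show ?thesis by (simp add: word_inv_def)
qed

text \<open>Erase the value at \<open>n + 1\<close>. If all groups are still met, the result is a
  word with the same number of groups. Otherwise base \<open>n + 1\<close> was alone in its group,
  and undoing \<open>shift\<close> closes the gap.\<close>

lemma words_Suc_cases:
  assumes f: "f \<in> words m (Suc n) k"
  obtains (old) h p where "h \<in> words m n k" "p \<le> k * m" "f = h(Suc n := p)"
  | (new) h p k' l where "k = Suc k'" "h \<in> words m n k'" "p \<le> k * m" "grp m p = Suc l"
      "f = (shift m l \<circ> h)(Suc n := p)"
proof (cases "f(Suc n := 0) \<in> words m n k")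
  case True
  then show ?thesis using words_le[OF f, of "Suc n"] by (intro old[of "f(Suc n := 0)" "f (Suc n)"]) auto
next
  case False
  let ?h = "f(Suc n := 0)"
  have h0: "?h i = 0" if "i \<notin> {1..n}" for i using f that by (auto simp: words_def)
  have hle: "?h i \<le> k * m" for i using f by (auto simp: words_def)
  have "\<not> {1..k} \<subseteq> range (grp m \<circ> ?h)" using False h0 hle unfolding words_def by blast
  \<comment> \<open>\<open>g\<close> is the group that only base \<open>n + 1\<close> meets.\<close>
  then obtain g where g: "g \<in> {1..k}" "\<And>i. grp m (?h i) \<noteq> g" by force
  obtain l where l: "g = Suc l" using g by (cases g) auto
  obtain k' where k: "k = Suc k'" using g by (cases k) auto
  from l g k have lk: "l \<le> k'" by auto
  from words_hits[OF f g(1)] obtain i where i: "i \<in> {1..Suc n}" "grp m (f i) = g" by blast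
  have "i = Suc n" using g(2)[of i] i(2) by (auto split: if_splits)
  then have p: "grp m (f (Suc n)) = Suc l" using i l by simp
  define e where "e i = (SOME x. ?h i = shift m l x)" for i
  have e: "?h i = shift m l (e i)" for i
  proof -
    have "grp m (?h i) \<noteq> Suc l" using g(2) l by blast
    then obtain x where "?h i = shift m l x" by (rule shift_surj)
    then show ?thesis unfolding e_def by (rule someI)
  qed
  have "{1..k'} \<subseteq> range (grp m \<circ> e)"
  proof
    fix g' assume g': "g' \<in> {1..k'}"
    \<comment> \<open>\<open>g''\<close> is the group to which \<open>shift m l\<close> sends group
      \<open>g'\<close>.\<close>
    define g'' where "g'' = (if g' \<le> l then g' else Suc g')"
    have "g'' \<in> {1..k}" using g' k by (auto simp: g''_def)
    from words_hits[OF f this] obtain i where i: "i \<in> {1..Suc n}" "grp m (f i) = g''" by blast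
    have "g'' \<noteq> Suc l" by (auto simp: g''_def)
    then have "i \<noteq> Suc n" using p i by auto
    then have "grp m (shift m l (e i)) = g''" using e[of i] i by simp
    then have "grp m (e i) = g'" by (auto simp: grp_shift g''_def split: if_splits)
    then show "g' \<in> range (grp m \<circ> e)" by force
  qed
  moreover have "e i \<le> k' * m" for i
    using hle[of i] e[of i] shift_le_iff[OF lk] k by metis
  moreover have "e i = 0" if "i \<notin> {1..n}" for i
    using h0[OF that] e[of i] by (auto simp: shift_def split: if_splits)
  ultimately have "e \<in> words m n k'" by (auto simp: words_def)
  moreover have "f = (shift m l \<circ> e)(Suc n := f (Suc n))"
    by (auto simp: fun_eq_iff simp flip: e)
  ultimately show ?thesis using new k p words_le[OF f] by blast
qed

text \<open>On the left a base up to \<open>n\<close> meets group \<open>l + 1\<close>; on the right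
  the values at such bases avoid it. This makes the old and the new case of the decomposition
  disjoint.\<close>

lemma shift_update_neq:
  assumes "f \<in> words m n k" "h \<in> words m n k'" "l < k"
  shows "f(Suc n := p) \<noteq> (shift m l \<circ> h)(Suc n := p')"
proof
  assume eq: "f(Suc n := p) = (shift m l \<circ> h)(Suc n := p')"
  from assms(3) have "Suc l \<in> {1..k}" by auto
  from words_hits[OF assms(1) this] obtain i where i: "i \<in> {1..n}" "grp m (f i) = Suc l" by blast
  then have "f i = shift m l (h i)" using fun_cong[OF eq, of i] by auto
  then show False using i grp_shift_neq by metis
qed

lemma inj_on_word_update:
  "inj_on (\<lambda>(f, p). f(Suc n := p)) (words m n k \<times> P)"
proof (intro inj_onI, clarsimp)
  fix f p f' p'
  assume f: "f \<in> words m n k" "f' \<in> words m n k" and eq: "f(Suc n := p) = f'(Suc n := p')"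
  have "f i = f' i" for i
    using fun_cong[OF eq, of i] words_0[OF f(1), of "Suc n"] words_0[OF f(2), of "Suc n"]
    by (cases "i = Suc n") auto
  moreover have "p = p'" using fun_cong[OF eq, of "Suc n"] by simp
  ultimately show "f = f' \<and> p = p'" by blast
qed

text \<open>The value at \<open>n + 1\<close> reveals \<open>p\<close>, hence the inserted group;
  \<open>shift\<close> for that group is injective, which recovers \<open>f\<close> on the other
  bases, while at \<open>n + 1\<close> both words vanish.\<close>

lemma inj_on_word_shift_update:
  "inj_on (\<lambda>(f, p). (shift m (grp m p - 1) \<circ> f)(Suc n := p)) (words m n k \<times> P)"
proof (intro inj_onI, clarsimp)
  fix f p f' p'
  assume f: "f \<in> words m n k" "f' \<in> words m n k"
    and eq: "(shift m (grp m p - Suc 0) \<circ> f)(Suc n := p) = (shift m (grp m p' - Suc 0) \<circ> f')(Suc n := p')"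
  have p: "p = p'" using fun_cong[OF eq, of "Suc n"] by simp
  have "f i = f' i" for i
    using fun_cong[OF eq, of i] words_0[OF f(1), of "Suc n"] words_0[OF f(2), of "Suc n"]
      injD[OF inj_shift] p
    by (cases "i = Suc n") auto
  then show "f = f' \<and> p = p'" using p by blast
qed

lemma words_Suc_0: "words m (Suc n) 0 = (\<lambda>(f, p). f(Suc n := p)) ` (words m n 0 \<times> {..0 * m})"
proof
  show "words m (Suc n) 0 \<subseteq> (\<lambda>(f, p). f(Suc n := p)) ` (words m n 0 \<times> {..0 * m})"
  proof
    fix f assume "f \<in> words m (Suc n) 0"
    then show "f \<in> (\<lambda>(f, p). f(Suc n := p)) ` (words m n 0 \<times> {..0 * m})"
      by (cases rule: words_Suc_cases) force+
  qed
qed (auto intro: words_update)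

lemma words_Suc_Suc:
  "words m (Suc n) (Suc k) =
     (\<lambda>(f, p). f(Suc n := p)) ` (words m n (Suc k) \<times> {..Suc k * m}) \<union>
     (\<lambda>(f, p). (shift m (grp m p - 1) \<circ> f)(Suc n := p)) ` (words m n k \<times> {1..Suc k * m})"
  (is "?L = ?A \<union> ?B")
proof
  show "?L \<subseteq> ?A \<union> ?B"
  proof
    fix f assume "f \<in> ?L"
    then show "f \<in> ?A \<union> ?B"
    proof (cases rule: words_Suc_cases)
      case (old h p)
      then show ?thesis by force
    next
      case (new h p k' l)
      have "p \<noteq> 0"
      proof
        assume "p = 0"
        then show False using new(4) by simp
      qed
      then have "(h, p) \<in> words m n k \<times> {1..Suc k * m}" using new by auto
      moreover have "f = (\<lambda>(f, p). (shift m (grp m p - 1) \<circ> f)(Suc n := p)) (h, p)"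
        using new by simp
      ultimately show ?thesis by blast
    qed
  qed
  have "grp m p = Suc (grp m p - 1)" if "1 \<le> p" for p
    using that grp_eq_0_iff[of p] by linarith
  then have "?B \<subseteq> ?L"
    by (auto intro!: words_shift_update simp del: mult_Suc)
  moreover have "?A \<subseteq> ?L"
    by (auto intro!: words_update simp del: mult_Suc)
  ultimately show "?A \<union> ?B \<subseteq> ?L" by blast
qed

section \<open>Standard words and the recurrences of the generating functions\<close>

lemma sum_q_var: "(\<Sum>p\<le>N. q_var ^ (N - p)) = q_int (Suc N)"
  unfolding q_int_def
  by (rule sum.reindex_bij_witness[of _ "\<lambda>i. N - i" "\<lambda>p. N - p"]) auto

lemma sum_q_var_1: "(\<Sum>p=1..N. q_var ^ (N - p)) = q_int N"
  unfolding q_int_def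
  by (rule sum.reindex_bij_witness[of _ "\<lambda>i. N - i" "\<lambda>p. N - p"]) auto

lemma std_words_Suc_0:
  "std_words m (Suc n) 0 = (\<lambda>(f, p). f(Suc n := p)) ` (std_words m n 0 \<times> {..0 * m})"
proof -
  have "words m n 0 = {\<lambda>_. 0}" for n by (auto simp: words_def)
  then have "std_words m n 0 = {\<lambda>_. 0}" for n by (auto simp: std_words_def fresh_ok_def)
  then show ?thesis by auto
qed

lemma fresh_ok_update: "i \<in> {1..n} \<Longrightarrow> fresh_ok m (f(Suc n := p)) i \<longleftrightarrow> fresh_ok m f i"
proof -
  assume i: "i \<in> {1..n}"
  have "(grp m \<circ> f(Suc n := p)) ` {1..<i} = (grp m \<circ> f) ` {1..<i}"
    using i by (intro image_cong) auto
  then show ?thesis using i by (auto simp: fresh_ok_def)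
qed

lemma std_words_update:
  assumes "f(Suc n := p) \<in> words m (Suc n) k" "\<forall>i\<in>{1..n}. fresh_ok m f i"
    "fresh_ok m (f(Suc n := p)) (Suc n)"
  shows "f(Suc n := p) \<in> std_words m (Suc n) k"
proof -
  have "fresh_ok m (f(Suc n := p)) i" if "i \<in> {1..Suc n}" for i
  proof (cases "i = Suc n")
    case False
    then have "i \<in> {1..n}" using that by auto
    then show ?thesis using fresh_ok_update assms(2) by blast
  qed (use assms(3) in simp)
  then show ?thesis using assms(1) by (simp add: std_words_def)
qed

text \<open>If the group of base \<open>n + 1\<close> is already met or zero,
  \<open>fresh_ok\<close> asks nothing of this base. If base \<open>n + 1\<close> opens a group, the
  group must be the last one and the position its last one. Opening the last group moves no
  position, so the second set involves no \<open>shift\<close>.\<close>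

lemma std_words_Suc_Suc:
  "std_words m (Suc n) (Suc k) =
     (\<lambda>(f, p). f(Suc n := p)) ` (std_words m n (Suc k) \<times> {..Suc k * m}) \<union>
     (\<lambda>f. f(Suc n := Suc k * m)) ` std_words m n k"
  (is "?L = ?A \<union> ?B")
proof
  have img: "(grp m \<circ> f(Suc n := p)) ` {1..<Suc n} = (grp m \<circ> f) ` {1..n}" for f p
    by (intro image_cong) auto
  have sh: "shift m k \<circ> f = f" if "f \<in> words m n k" for f
    using words_le[OF that] by (auto simp: shift_def)
  show "?L \<subseteq> ?A \<union> ?B"
  proof
    fix f assume f: "f \<in> ?L"
    then have "f \<in> words m (Suc n) (Suc k)" by (simp add: std_words_def)
    then show "f \<in> ?A \<union> ?B"
    proof (cases rule: words_Suc_cases)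
      case (old h p)
      have "\<forall>i\<in>{1..n}. fresh_ok m f i" using f unfolding std_words_def by auto
      then have "\<forall>i\<in>{1..n}. fresh_ok m h i" using fresh_ok_update old(3) by blast
      then have "(h, p) \<in> std_words m n (Suc k) \<times> {..Suc k * m}"
        using old(1,2) by (simp add: std_words_def)
      moreover have "f = (\<lambda>(f, p). f(Suc n := p)) (h, p)" using old(3) by simp
      ultimately show ?thesis by blast
    next
      case (new h p k' l)
      let ?h = "shift m l \<circ> h"
      have "fresh_ok m (?h(Suc n := p)) (Suc n)" using f new by (simp add: std_words_def)
      moreover have notin: "Suc l \<notin> (grp m \<circ> ?h) ` {1..n}"
      proof
        assume "Suc l \<in> (grp m \<circ> ?h) ` {1..n}"
        then obtain i where "grp m (shift m l (h i)) = Suc l" by (auto simp del: One_nat_def)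
        then show False using grp_shift_neq by blast
      qed
      ultimately have *: "m dvd p" "{1..<Suc l} \<subseteq> (grp m \<circ> ?h) ` {1..n}"
        using new(4) unfolding fresh_ok_def img by auto
      \<comment> \<open>\<open>p\<close> is a multiple of \<open>m\<close> in group
        \<open>l + 1\<close>, and the last position is the only one.\<close>
      have p: "p = Suc l * m"
      proof (rule grp_mod_unique)
        show "grp m p = grp m (Suc l * m)" using new by (simp del: mult_Suc)
        show "p mod m = Suc l * m mod m" using *(1) by (simp del: mult_Suc)
      qed
      \<comment> \<open>If there were a group \<open>l + 2\<close>, the first base \<open>i0\<close>
        meeting it would be at most \<open>n\<close>, and \<open>fresh_ok\<close> at
        \<open>i0\<close> would require a still smaller base in group \<open>l + 1\<close>. But only
        base \<open>n + 1\<close> meets that group.\<close>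
      have "l = k"
      proof (rule ccontr)
        assume "l \<noteq> k"
        moreover have "l \<le> k" using new grp_le_iff[of p "Suc k"] by simp
        ultimately have lk: "Suc l \<le> k" by simp
        have "Suc (Suc l) \<in> {1..Suc k}" using lk by auto
        with \<open>f \<in> words m (Suc n) (Suc k)\<close> obtain i where
          i: "i \<in> {1..Suc n}" "grp m (f i) = Suc (Suc l)" using words_hits by blast
        define i0 where "i0 = (LEAST i. i \<in> {1..Suc n} \<and> grp m (f i) = Suc (Suc l))"
        have i0: "i0 \<in> {1..Suc n}" "grp m (f i0) = Suc (Suc l)"
          unfolding i0_def using LeastI[of "\<lambda>i. i \<in> {1..Suc n} \<and> grp m (f i) = Suc (Suc l)" i] i
          by blast+
        have least: "grp m (f i) \<noteq> Suc (Suc l)" if "i \<in> {1..<i0}" for i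
          using not_less_Least[of i "\<lambda>i. i \<in> {1..Suc n} \<and> grp m (f i) = Suc (Suc l)"] that i0
          unfolding i0_def by auto
        have "i0 \<noteq> Suc n" using i0 new by auto
        with i0 have "i0 \<in> {1..n}" by auto
        have "fresh_ok m f i0" using f i0 by (simp add: std_words_def)
        moreover have "f i0 \<noteq> 0" 
        proof
          assume "f i0 = 0"
          then show False using i0(2) by simp
        qed
        moreover have "Suc (Suc l) \<notin> (grp m \<circ> f) ` {1..<i0}"
          using least by (metis comp_apply imageE)
        ultimately have "{1..<Suc (Suc l)} \<subseteq> (grp m \<circ> f) ` {1..<i0}"
          unfolding fresh_ok_def i0(2) by blast
        moreover have "Suc l \<in> {1..<Suc (Suc l)}" by auto
        ultimately obtain i1 where "i1 \<in> {1..<i0}" "grp m (f i1) = Suc l" by fastforce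
        then have i1: "i1 \<in> {1..n}" "i1 \<noteq> Suc n" "grp m (f i1) = Suc l"
          using \<open>i0 \<in> {1..n}\<close> by auto
        then have "f i1 = ?h i1" using new(5) by simp
        then have "grp m (shift m l (h i1)) = Suc l" using i1(3) by simp
        then show False using grp_shift_neq by blast
      qed
      have hk: "h \<in> words m n k" using new(1,2) by simp
      have "f = h(Suc n := Suc k * m)"
        using new(5) sh[OF hk] p unfolding \<open>l = k\<close> by (simp only:)
      moreover have "\<forall>i\<in>{1..n}. fresh_ok m f i" using f unfolding std_words_def by auto
      ultimately have "\<forall>i\<in>{1..n}. fresh_ok m h i" using fresh_ok_update by blast
      then have "h \<in> std_words m n k" using hk by (simp add: std_words_def)
      then show ?thesis using \<open>f = h(Suc n := Suc k * m)\<close> by blast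
    qed
  qed
  have "f(Suc n := p) \<in> ?L" if "f \<in> std_words m n (Suc k)" "p \<le> Suc k * m" for f p
  proof -
    have fw: "f \<in> words m n (Suc k)" using that by (simp add: std_words_def)
    have "fresh_ok m (f(Suc n := p)) (Suc n)"
      unfolding fresh_ok_def img
    proof (intro impI)
      assume "(f(Suc n := p)) (Suc n) \<noteq> 0" "grp m ((f(Suc n := p)) (Suc n)) \<notin> (grp m \<circ> f) ` {1..n}"
      then have p: "p \<noteq> 0" "grp m p \<notin> (grp m \<circ> f) ` {1..n}" by auto
      then have "grp m p \<in> {1..Suc k}" unfolding grp_mem_iff using that by simp
      from words_hits[OF fw this] have "grp m p \<in> (grp m \<circ> f) ` {1..n}"
        by (metis comp_apply image_eqI)
      with p(2) show "m dvd (f(Suc n := p)) (Suc n) \<and>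
          {1..<grp m ((f(Suc n := p)) (Suc n))} \<subseteq> (grp m \<circ> f) ` {1..n}" by blast
    qed
    moreover have "\<forall>i\<in>{1..n}. fresh_ok m f i" using that by (simp add: std_words_def)
    ultimately show ?thesis using words_update[OF fw that(2)] std_words_update by blast
  qed
  moreover have "f(Suc n := Suc k * m) \<in> ?L" if "f \<in> std_words m n k" for f
  proof -
    have fw: "f \<in> words m n k" using that by (simp add: std_words_def)
    have "fresh_ok m (f(Suc n := Suc k * m)) (Suc n)"
      unfolding fresh_ok_def img
    proof (intro impI conjI)
      show "m dvd (f(Suc n := Suc k * m)) (Suc n)" by simp
      show "{1..<grp m ((f(Suc n := Suc k * m)) (Suc n))} \<subseteq> (grp m \<circ> f) ` {1..n}"
        
      proof
        fix g assume "g \<in> {1..<grp m ((f(Suc n := Suc k * m)) (Suc n))}"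
        then have "g \<in> {1..<Suc k}" by (simp only: fun_upd_same grp_mult)
        then have "g \<in> {1..k}" by auto
        from words_hits[OF fw this] show "g \<in> (grp m \<circ> f) ` {1..n}"
          by (metis comp_apply image_eqI)
      qed
    qed
    moreover have "\<forall>i\<in>{1..n}. fresh_ok m f i" using that by (simp add: std_words_def)
    moreover have "f(Suc n := Suc k * m) \<in> words m (Suc n) (Suc k)"
      using words_shift_update[OF fw order_refl grp_mult] unfolding sh[OF fw] .
    ultimately show ?thesis using std_words_update by blast
  qed
  ultimately show "?A \<union> ?B \<subseteq> ?L" by auto
qed

text \<open>Base \<open>n + 1\<close> adds \<open>k * m - p\<close> inversions whatever
  \<open>f\<close> is, so the sum factors. The set \<open>X\<close> is arbitrary so that the same
  computation serves all words and the standard ones.\<close>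

lemma sum_old_words:
  assumes "X \<subseteq> words m n k"
  shows "(\<Sum>f\<in>(\<lambda>(f, p). f(Suc n := p)) ` (X \<times> {..k * m}). q_var ^ word_inv m (Suc n) k f) =
           q_int (Suc (k * m)) * (\<Sum>f\<in>X. q_var ^ word_inv m n k f)"
proof -
  have "inj_on (\<lambda>(f, p). f(Suc n := p)) (X \<times> {..k * m})"
    by (rule inj_on_subset[OF inj_on_word_update[of n k "{..k * m}"]]) (use assms in auto)
  then have "(\<Sum>f\<in>(\<lambda>(f, p). f(Suc n := p)) ` (X \<times> {..k * m}). q_var ^ word_inv m (Suc n) k f) =
    (\<Sum>(f, p)\<in>X \<times> {..k * m}. q_var ^ word_inv m (Suc n) k (f(Suc n := p)))"
    by (simp add: sum.reindex case_prod_unfold)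
  also have "\<dots> = (\<Sum>(f, p)\<in>X \<times> {..k * m}. q_var ^ word_inv m n k f * q_var ^ (k * m - p))"
    by (rule sum.cong)
       (use assms in \<open>auto simp: subset_iff word_inv_update power_add simp del: Nat.add_diff_assoc\<close>)
  also have "\<dots> = (\<Sum>f\<in>X. q_var ^ word_inv m n k f) * (\<Sum>p\<le>k * m. q_var ^ (k * m - p))"
    by (simp only: sum_product sum.cartesian_product)
  finally show ?thesis by (simp only: sum_q_var mult.commute)
qed

lemma sum_words_Suc_0:
  "(\<Sum>f\<in>words m (Suc n) 0. q_var ^ word_inv m (Suc n) 0 f) =
     (\<Sum>f\<in>words m n 0. q_var ^ word_inv m n 0 f)"
  unfolding words_Suc_0 using sum_old_words[OF order_refl, of n 0] by (simp add: q_int_def)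

lemma sum_std_words_Suc_0:
  "(\<Sum>f\<in>std_words m (Suc n) 0. q_var ^ word_inv m (Suc n) 0 f) =
     (\<Sum>f\<in>std_words m n 0. q_var ^ word_inv m n 0 f)"
proof -
  have "std_words m n 0 \<subseteq> words m n 0" by (auto simp: std_words_def)
  from sum_old_words[OF this] show ?thesis
    unfolding std_words_Suc_0 by (simp add: q_int_def)
qed

text \<open>The two parts of \<open>words_Suc_Suc\<close> are disjoint and injectively parametrized.
  In the second part \<open>p\<close> starts at 1, which shortens the factor from
  \<open>q_int (Suc (Suc k * m))\<close> to \<open>q_int (Suc k * m)\<close>.\<close>

lemma sum_words_Suc_Suc:
  "(\<Sum>f\<in>words m (Suc n) (Suc k). q_var ^ word_inv m (Suc n) (Suc k) f) =
     q_int (Suc (Suc k * m)) * (\<Sum>f\<in>words m n (Suc k). q_var ^ word_inv m n (Suc k) f) +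
     q_int (Suc k * m) * (\<Sum>f\<in>words m n k. q_var ^ word_inv m n k f)"
proof -
  let ?u = "\<lambda>(f, p). f(Suc n := p)" and ?v = "\<lambda>(f, p). (shift m (grp m p - 1) \<circ> f)(Suc n := p)"
  let ?A = "words m n (Suc k) \<times> {..Suc k * m}" and ?B = "words m n k \<times> {1..Suc k * m}"
  have gp: "grp m p = Suc (grp m p - 1)" if "1 \<le> p" for p
    using that grp_eq_0_iff[of p] by linarith
  have disj: "?u ` ?A \<inter> ?v ` ?B = {}"
  proof -
    have "?u a \<noteq> ?v b" if ab: "a \<in> ?A" "b \<in> ?B" for a b
    proof -
      obtain f p h p' where [simp]: "a = (f, p)" "b = (h, p')" by (cases a, cases b) blast
      have "grp m p' \<noteq> 0" "grp m p' \<le> Suc k" using ab grp_le_iff[of p' "Suc k"] by auto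
      then have "grp m p' - 1 < Suc k" by simp
      then show ?thesis using ab shift_update_neq[of f n "Suc k" h k "grp m p' - 1" p p'] by auto
    qed
    then show ?thesis by blast
  qed
  have "(\<Sum>f\<in>?v ` ?B. q_var ^ word_inv m (Suc n) (Suc k) f) =
      (\<Sum>(f, p)\<in>?B. q_var ^ word_inv m (Suc n) (Suc k) (?v (f, p)))"
    using inj_on_word_shift_update[of n k "{1..Suc k * m}"] by (simp add: sum.reindex case_prod_unfold)
  also have "\<dots> = (\<Sum>(f, p)\<in>?B. q_var ^ word_inv m n k f * q_var ^ (Suc k * m - p))"
    using gp
    by (intro sum.cong)
       (auto simp: word_inv_shift_update power_add simp del: mult_Suc Nat.add_diff_assoc)
  also have "\<dots> = (\<Sum>f\<in>words m n k. q_var ^ word_inv m n k f) *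
      (\<Sum>p=1..Suc k * m. q_var ^ (Suc k * m - p))"
    by (simp only: sum_product sum.cartesian_product)
  also have "\<dots> = q_int (Suc k * m) * (\<Sum>f\<in>words m n k. q_var ^ word_inv m n k f)"
    by (simp only: sum_q_var_1 mult.commute)
  finally show ?thesis
    unfolding words_Suc_Suc using disj sum_old_words[OF order_refl, of n "Suc k"]
    by (subst sum.union_disjoint) (simp_all add: finite_words)
qed

text \<open>A base that opens the last group sits at the last position and creates no inversion, so
  the second term carries no factor.\<close>

lemma sum_std_words_Suc_Suc:
  "(\<Sum>f\<in>std_words m (Suc n) (Suc k). q_var ^ word_inv m (Suc n) (Suc k) f) =
     q_int (Suc (Suc k * m)) * (\<Sum>f\<in>std_words m n (Suc k). q_var ^ word_inv m n (Suc k) f) +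
     (\<Sum>f\<in>std_words m n k. q_var ^ word_inv m n k f)"
proof -
  let ?u = "\<lambda>(f, p). f(Suc n := p)" and ?v = "\<lambda>f. f(Suc n := Suc k * m)"
  let ?A = "std_words m n (Suc k) \<times> {..Suc k * m}" and ?B = "std_words m n k"
  have sub: "std_words m n k \<subseteq> words m n k" for k by (auto simp: std_words_def)
  have v: "?v f = (shift m k \<circ> f)(Suc n := Suc k * m)" if "f \<in> words m n k" for f
    using words_le[OF that] by (auto simp: shift_def fun_eq_iff)
  have disj: "?u ` ?A \<inter> ?v ` ?B = {}"
  proof -
    have "?u a \<noteq> ?v b" if ab: "a \<in> ?A" "b \<in> ?B" for a b
    proof -
      have a: "fst a \<in> words m n (Suc k)" and b: "b \<in> words m n k" using ab subsetD[OF sub] by auto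
      show ?thesis
        unfolding case_prod_unfold v[OF b] by (rule shift_update_neq[OF a b lessI])
    qed
    then show ?thesis by blast
  qed
  have "inj_on ?v ?B"
    using inj_on_word_update[of n k UNIV] sub[of k] by (force simp: inj_on_def simp del: mult_Suc)
  then have "(\<Sum>f\<in>?v ` ?B. q_var ^ word_inv m (Suc n) (Suc k) f) =
      (\<Sum>f\<in>?B. q_var ^ word_inv m (Suc n) (Suc k) (?v f))"
    by (simp add: sum.reindex del: mult_Suc)
  also have "\<dots> = (\<Sum>f\<in>?B. q_var ^ word_inv m n k f)"
  proof (rule sum.cong)
    fix f assume "f \<in> ?B"
    then have f: "f \<in> words m n k" using sub by blast
    show "q_var ^ word_inv m (Suc n) (Suc k) (?v f) = q_var ^ word_inv m n k f"
      using word_inv_shift_update[OF f, of "Suc k * m" k] v[OF f] by (simp del: mult_Suc)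
  qed simp
  finally show ?thesis
    unfolding std_words_Suc_Suc using disj sum_old_words[OF sub[of "Suc k"]]
      finite_subset[OF sub finite_words]
    by (subst sum.union_disjoint) (simp_all)
qed

text \<open>The two recurrences differ only in the factor \<open>q_int (Suc k * m)\<close> of the
  second term, and this is the quotient of \<open>q_fact m (Suc k)\<close> by
  \<open>q_fact m k\<close>. Without bases there is a word only for \<open>k = 0\<close>, and it is
  standard.\<close>

lemma sum_words_eq:
  "(\<Sum>f\<in>words m n k. q_var ^ word_inv m n k f) =
     q_fact m k * (\<Sum>f\<in>std_words m n k. q_var ^ word_inv m n k f)"
proof (induction n arbitrary: k)
  case 0
  have "words m 0 (Suc k) = {}" for k
    using words_hits[of _ 0 "Suc k" 1] by auto
  moreover have "std_words m 0 k = words m 0 k" for k by (auto simp: std_words_def)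
  ultimately show ?case by (cases k) (simp_all add: q_fact_def)
next
  case (Suc n)
  show ?case
  proof (cases k)
    case 0
    then show ?thesis using Suc[of 0] by (simp add: sum_words_Suc_0 sum_std_words_Suc_0)
  next
    case (Suc k')
    have "q_fact m (Suc k') = q_int (Suc k' * m) * q_fact m k'"
      by (simp add: q_fact_def mult.commute)
    then show ?thesis
      unfolding Suc sum_words_Suc_Suc sum_std_words_Suc_Suc
      using Suc.IH[of "Suc k'"] Suc.IH[of k'] by (simp add: algebra_simps del: mult_Suc)
  qed
qed

section \<open>Words of CR-ordered partitions\<close>

lemma zeta_power: "zeta m ^ c = exp (2 * of_real pi * \<i> * of_nat c / of_nat m)"
  by (simp add: zeta_def mult_ac flip: exp_of_nat_mult)

lemma zeta_power_eq_iff: "zeta m ^ a = zeta m ^ b \<longleftrightarrow> a mod m = b mod m"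
  unfolding zeta_power using complex_root_unity_eq[OF m_pos, of a b] by (simp add: mult_ac)

lemma zeta_neq_0 [simp]: "zeta m \<noteq> 0"
  by (simp add: zeta_def)

text \<open>Colors range over all natural numbers and count modulo \<open>m\<close>, because
  \<open>zeta m\<close> is a primitive \<open>m\<close>-th root of unity. Translations then simply
  add exponents.\<close>

lemma colored_eq_iff: "colored m i c = colored m i' c' \<longleftrightarrow> i = i' \<and> c mod m = c' mod m"
proof -
  have "colored m i c = colored m i' c' \<longleftrightarrow> i = i' \<and> zeta m ^ c = zeta m ^ c'"
    by (auto simp: colored_def smult_vec_def unit_vec_def fun_eq_iff split: if_splits)
  then show ?thesis by (simp add: zeta_power_eq_iff)
qed

lemma colored_mod [simp]: "colored m i (c mod m) = colored m i c"
  by (simp add: colored_eq_iff)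

lemma colored_neq_zero [simp]: "colored m i c \<noteq> zero_vec" "zero_vec \<noteq> colored m i c"
proof -
  have "colored m i c i \<noteq> zero_vec i"
    by (simp add: colored_def smult_vec_def unit_vec_def Defs.zero_vec_def)
  then show "colored m i c \<noteq> zero_vec" "zero_vec \<noteq> colored m i c" by auto
qed

lemma ex_colored_less: "(\<exists>c<m. colored m i c \<in> S) \<longleftrightarrow> (\<exists>c. colored m i c \<in> S)"
proof
  assume "\<exists>c. colored m i c \<in> S"
  then obtain c where "colored m i (c mod m) \<in> S" by auto
  moreover have "c mod m < m" using m_pos by simp
  ultimately show "\<exists>c<m. colored m i c \<in> S" by blast
qed blast

lemma all_colored_less: "(\<forall>c<m. colored m i c \<in> S) \<longleftrightarrow> (\<forall>c. colored m i c \<in> S)"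
  using ex_colored_less[of i "- S"] by auto

lemma smult_colored: "smult_vec (zeta m ^ a) (colored m i c) = colored m i (a + c)"
  by (simp add: colored_def smult_vec_def power_add mult.assoc)

lemma smult_zero_vec [simp]: "smult_vec z zero_vec = zero_vec"
  by (simp add: smult_vec_def Defs.zero_vec_def)

lemma inj_smult_vec: "inj (smult_vec (zeta m ^ a))"
  by (rule injI) (simp add: smult_vec_def fun_eq_iff)

lemma colored_mem_smult_set: "colored m i (a + c) \<in> smult_set (zeta m ^ a) S \<longleftrightarrow> colored m i c \<in> S"
  unfolding smult_set_def smult_colored[symmetric] by (simp add: inj_image_mem_iff[OF inj_smult_vec])

lemma zero_mem_smult_set: "zero_vec \<in> smult_set (zeta m ^ a) S \<longleftrightarrow> zero_vec \<in> S"
  unfolding smult_set_def using inj_image_mem_iff[OF inj_smult_vec, of a zero_vec S] by simp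

lemma smult_set_smult_set: "smult_set (zeta m ^ a) (smult_set (zeta m ^ b) S) = smult_set (zeta m ^ (a + b)) S"
  by (simp add: smult_set_def smult_vec_def image_image power_add mult.assoc)

lemma smult_set_cong: "a mod m = b mod m \<Longrightarrow> smult_set (zeta m ^ a) S = smult_set (zeta m ^ b) S"
  using zeta_power_eq_iff by metis

lemma smult_set_0 [simp]: "smult_set 1 S = S"
  by (simp add: smult_set_def smult_vec_def)

text \<open>\<open>(m - 1) * b\<close> serves as \<open>- b\<close> modulo \<open>m\<close> within
  the natural numbers.\<close>

lemma mod_complement: "(a + (m - 1) * b + b) mod m = a mod m"
proof -
  have "(m - 1) * b + b = m * b" using m_pos by (simp add: algebra_simps)
  then show ?thesis by (simp add: add.assoc)
qed

lemma color_exists: obtains c where "(a + c) mod m = b mod m"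
  using mod_complement[of b a] by (intro that[of "b + (m - 1) * a"]) (simp add: ac_simps)

lemma mod_add_self_iff: "(x + j) mod m = j mod m \<longleftrightarrow> m dvd x"
  using mod_eq_dvd_iff_nat[of j "x + j" m] by simp

lemma mem_ground_iff: "v \<in> ground m n \<longleftrightarrow> v = zero_vec \<or> (\<exists>i\<in>{1..n}. \<exists>c. v = colored m i c)"
proof -
  have "v = colored m i c \<Longrightarrow> \<exists>c<m. v = colored m i c" for i c
    using m_pos by (intro exI[of _ "c mod m"]) simp
  then show ?thesis unfolding ground_def by blast
qed

lemma zero_mem_ground [simp]: "zero_vec \<in> ground m n"
  by (simp add: mem_ground_iff)

lemma colored_mem_ground [simp]: "colored m i c \<in> ground m n \<longleftrightarrow> i \<in> {1..n}"
  by (auto simp: mem_ground_iff colored_eq_iff)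

text \<open>The block at position \<open>j\<close> of the partition with word \<open>f\<close>: within a group, a position is
  determined by its residue modulo \<open>m\<close>.\<close>

definition block :: "nat \<Rightarrow> (nat \<Rightarrow> nat) \<Rightarrow> nat \<Rightarrow> cvec set" where
  "block n f j = {v. j = 0 \<and> v = zero_vec} \<union>
     {colored m i c | i c. i \<in> {1..n} \<and> grp m (f i) = grp m j \<and> (j = 0 \<or> (f i + c) mod m = j mod m)}"

definition blocks :: "nat \<Rightarrow> nat \<Rightarrow> (nat \<Rightarrow> nat) \<Rightarrow> cvec set list" where
  "blocks n k f = map (block n f) [0..<k * m + 1]"

section \<open>The blocks of a word form a CR-ordered partition\<close>

lemma zero_mem_block [simp]: "zero_vec \<in> block n f j \<longleftrightarrow> j = 0"
  by (auto simp: block_def)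

lemma colored_mem_block:
  "colored m i c \<in> block n f j \<longleftrightarrow>
     i \<in> {1..n} \<and> grp m (f i) = grp m j \<and> (j = 0 \<or> (f i + c) mod m = j mod m)"
  (is "?l = ?r")
proof
  assume ?l
  then obtain c' where *: "c mod m = c' mod m" "i \<in> {1..n}" "grp m (f i) = grp m j"
      "j = 0 \<or> (f i + c') mod m = j mod m"
    by (auto simp: block_def colored_eq_iff)
  then show ?r using mod_add_cong[OF refl *(1), of "f i"] by auto
qed (auto simp: block_def)

lemma blocks_nth [simp]: "j \<le> k * m \<Longrightarrow> blocks n k f ! j = block n f j"
  by (simp add: blocks_def del: upt_Suc)

lemma length_blocks [simp]: "length (blocks n k f) = k * m + 1"
  by (simp add: blocks_def)

lemma block_subset_ground: "block n f j \<subseteq> ground m n"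
  by (auto simp: block_def)

lemma mem_block_cases:
  assumes "v \<in> block n f j" "j > 0"
  obtains i c where "v = colored m i c"
  using assms by (auto simp: block_def)

text \<open>A colored element determines the group of its position and, in a nonzero group, also the
  residue; together they determine the position. The zero vector lies only in block 0.\<close>

lemma block_disjoint:
  assumes "v \<in> block n f j" "v \<in> block n f j'"
  shows "j = j'"
proof -
  have "v \<in> ground m n" using assms block_subset_ground by blast
  then consider "v = zero_vec" | i c where "v = colored m i c" by (auto simp: mem_ground_iff)
  then show ?thesis
  proof cases
    case 1
    then show ?thesis using assms by simp
  next
    case (2 i c)
    then have *: "grp m j = grp m j'" "j = 0 \<or> (f i + c) mod m = j mod m"
        "j' = 0 \<or> (f i + c) mod m = j' mod m"
      using assms by (auto simp: colored_mem_block)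
    have "j = 0 \<longleftrightarrow> j' = 0" using *(1) grp_eq_0_iff[of j] grp_eq_0_iff[of j'] by argo
    moreover have "j = j'" if "j \<noteq> 0" "j' \<noteq> 0"
      by (rule grp_mod_unique) (use * that in argo)+
    ultimately show ?thesis by linarith
  qed
qed

lemma block_covers:
  assumes "\<And>i. f i \<le> k * m" "v \<in> ground m n"
  shows "\<exists>j\<le>k * m. v \<in> block n f j"
proof -
  from assms(2) consider "v = zero_vec" | i c where "i \<in> {1..n}" "v = colored m i c"
    by (auto simp: mem_ground_iff)
  then show ?thesis
  proof cases
    case 1
    then show ?thesis by (intro exI[of _ 0]) simp
  next
    case (2 i c)
    show ?thesis
    proof (cases "grp m (f i)")
      case 0
      then show ?thesis using 2 by (intro exI[of _ 0]) (simp add: colored_mem_block)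
    next
      case (Suc l)
      obtain j where j: "grp m j = Suc l" "j mod m = (f i + c) mod m" by (rule grp_mod_exists)
      have "grp m (f i) \<le> k" using assms(1) by (simp add: grp_le_iff)
      then have "j \<le> k * m" using Suc j(1) grp_le_iff[of j k] by simp
      then show ?thesis using 2 j Suc by (auto simp: colored_mem_block)
    qed
  qed
qed

text \<open>Some base meets the group of \<open>j\<close>, and a suitable color moves its element to
  position \<open>j\<close>.\<close>

lemma block_nonempty:
  assumes "f \<in> words m n k" "j \<le> k * m"
  shows "block n f j \<noteq> {}"
proof (cases "j = 0")
  case True
  then have "zero_vec \<in> block n f j" by simp
  then show ?thesis by blast
next
  case False
  then have "grp m j \<in> {1..k}" unfolding grp_mem_iff using assms(2) by simp
  from words_hits[OF assms(1) this] obtain i where i: "i \<in> {1..n}" "grp m (f i) = grp m j" by blast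
  obtain c where "(f i + c) mod m = j mod m" by (rule color_exists)
  with i have "colored m i c \<in> block n f j" by (simp add: colored_mem_block)
  then show ?thesis by blast
qed

text \<open>Multiplication by \<open>zeta m ^ c\<close> adds \<open>c\<close> to all colors, which
  moves a block \<open>c\<close> places cyclically within its group.\<close>

lemma smult_block:
  assumes "j > 0" "grp m j = grp m j'" "(j + c) mod m = j' mod m"
  shows "smult_set (zeta m ^ c) (block n f j) = block n f j'"
proof -
  have j': "j' > 0" using assms(1,2) grp_eq_0_iff[of j] grp_eq_0_iff[of j'] by linarith
  show ?thesis
  proof
    show "smult_set (zeta m ^ c) (block n f j) \<subseteq> block n f j'"
    proof
      fix v assume "v \<in> smult_set (zeta m ^ c) (block n f j)"
      then obtain u where u: "u \<in> block n f j" "v = smult_vec (zeta m ^ c) u"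
        by (auto simp: smult_set_def)
      obtain i d where d: "u = colored m i d" using u(1) assms(1) by (rule mem_block_cases)
      then have "i \<in> {1..n}" "grp m (f i) = grp m j" "(f i + d) mod m = j mod m"
        using u(1) assms(1) by (simp_all add: colored_mem_block)
      moreover have "(f i + (c + d)) mod m = j' mod m"
        using mod_add_cong[OF \<open>(f i + d) mod m = j mod m\<close> refl, of c] assms(3)
        by (simp add: ac_simps)
      ultimately show "v \<in> block n f j'"
        using assms(2) by (simp add: u d smult_colored colored_mem_block)
    qed
    show "block n f j' \<subseteq> smult_set (zeta m ^ c) (block n f j)"
    proof
      fix v assume v: "v \<in> block n f j'"
      obtain i d where d: "v = colored m i d" using v j' by (rule mem_block_cases)
      then have *: "i \<in> {1..n}" "grp m (f i) = grp m j'" "(f i + d) mod m = j' mod m"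
        using v j' by (simp_all add: colored_mem_block)
      \<comment> \<open>\<open>?d\<close> is the color \<open>d - c\<close> modulo \<open>m\<close>,
        so the element in this color is the preimage of \<open>v\<close>.\<close>
      let ?d = "d + (m - 1) * c"
      have "(f i + ?d) mod m = (j' + (m - 1) * c) mod m"
        using mod_add_cong[OF *(3) refl, of "(m - 1) * c"] by (simp add: ac_simps)
      also have "\<dots> = (j + c + (m - 1) * c) mod m"
        using mod_add_cong[OF assms(3) refl, of "(m - 1) * c"] by simp
      also have "\<dots> = j mod m" using mod_complement[of j c] by (simp add: ac_simps)
      finally have "colored m i ?d \<in> block n f j" using * assms(2) by (simp add: colored_mem_block)
      then have "colored m i (c + ?d) \<in> smult_set (zeta m ^ c) (block n f j)"
        by (simp only: colored_mem_smult_set)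
      moreover have "colored m i (c + ?d) = v"
        unfolding d colored_eq_iff using mod_complement[of d c] by (simp add: ac_simps)
      ultimately show "v \<in> smult_set (zeta m ^ c) (block n f j)" by simp
    qed
  qed
qed

lemma distinct_blocks:
  assumes "f \<in> words m n k"
  shows "distinct (blocks n k f)"
proof -
  have "inj_on (block n f) {0..<k * m + 1}"
  proof (rule inj_onI)
    fix j j' assume j: "j \<in> {0..<k * m + 1}" and eq: "block n f j = block n f j'"
    then obtain v where "v \<in> block n f j" using block_nonempty[OF assms, of j] by auto
    then show "j = j'" using eq block_disjoint by metis
  qed
  then show ?thesis by (simp add: blocks_def distinct_map del: upt_Suc)
qed

lemma partition_on_blocks:
  assumes "f \<in> words m n k"
  shows "partition_on (ground m n) (set (blocks n k f))"
proof -
  have set: "set (blocks n k f) = block n f ` {..k * m}"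
    by (auto simp: blocks_def simp del: upt_Suc)
  show ?thesis unfolding set
  proof (rule partition_onI)
    show "\<Union> (block n f ` {..k * m}) = ground m n"
      using block_covers[of f k] words_le[OF assms] block_subset_ground by fastforce
    show "{} \<notin> block n f ` {..k * m}"
      using block_nonempty[OF assms] by fastforce
    show "disjnt p q" if "p \<in> block n f ` {..k * m}" "q \<in> block n f ` {..k * m}" "p \<noteq> q" for p q

    proof -
      from that obtain j j' where "p = block n f j" "q = block n f j'" "j \<noteq> j'" by auto
      then show ?thesis using block_disjoint unfolding disjnt_iff by blast
    qed
  qed
qed

lemma group_interval: "{l * m + 1..(l + 1) * m} = (\<lambda>c. l * m + 1 + c) ` {..<m}"
proof
  show "{l * m + 1..(l + 1) * m} \<subseteq> (\<lambda>c. l * m + 1 + c) ` {..<m}"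
  proof
    fix x assume "x \<in> {l * m + 1..(l + 1) * m}"
    then have "x = l * m + 1 + (x - (l * m + 1))" "x - (l * m + 1) \<in> {..<m}" by auto
    then show "x \<in> (\<lambda>c. l * m + 1 + c) ` {..<m}" by (rule image_eqI)
  qed
qed auto

lemma colored_labeling_blocks:
  assumes f: "f \<in> words m n k"
  shows "colored_labeling m n k (blocks n k f)"
  unfolding colored_labeling_def
proof (intro conjI allI impI ballI)
  fix l assume l: "l < k"
  have lk: "l * m + m \<le> k * m" using l mult_le_mono1[of "Suc l" k m] by simp
  have "(\<lambda>j. blocks n k f ! j) ` {l * m + 1..(l + 1) * m} = (\<lambda>c. block n f (l * m + 1 + c)) ` {..<m}"
  proof -
    show ?thesis unfolding group_interval using lk by (simp add: image_image)
  qed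
  also have "\<dots> = (\<lambda>c. smult_set (zeta m ^ c) (block n f (l * m + 1))) ` {..<m}"
  proof (rule image_cong)
    fix c assume "c \<in> {..<m}"
    then have "grp m (l * m + 1) = grp m (l * m + 1 + c)"
      using grp_eq_Suc_iff[of "l * m + 1" l] grp_eq_Suc_iff[of "l * m + 1 + c" l] by simp
    then show "block n f (l * m + 1 + c) = smult_set (zeta m ^ c) (block n f (l * m + 1))"
      using smult_block[of "l * m + 1" "l * m + 1 + c" c n f] by simp
  qed simp
  finally show "\<exists>S. (\<lambda>j. blocks n k f ! j) ` {l * m + 1..(l + 1) * m} =
      (\<lambda>c. smult_set (zeta m ^ c) S) ` {..<m}" by blast
qed (use distinct_blocks[OF f] partition_on_blocks[OF f] in \<open>auto simp: colored_mem_block\<close>)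

lemma blocks_CR_ordered:
  assumes f: "f \<in> words m n k"
  shows "blocks n k f \<in> CR_ordered m n k"
proof -
  have "blocks n k f ! (i + 1) = smult_set (zeta m) (blocks n k f ! i)"
    if i: "i \<in> {1..<k * m}" "\<not> m dvd i" for i
  proof -
    obtain l where l: "grp m i = Suc l" using i grp_eq_0_iff[of i] by (cases "grp m i") auto
    then have "l * m < i" "i \<le> Suc l * m" unfolding grp_eq_Suc_iff by auto
    \<comment> \<open>As \<open>i\<close> is not the last position of its group,
      \<open>i + 1\<close> belongs to the same group.\<close>
    moreover have "i \<noteq> Suc l * m" using i(2) by (metis dvd_triv_right)
    ultimately have "grp m (i + 1) = Suc l" unfolding grp_eq_Suc_iff by linarith
    then have "smult_set (zeta m ^ 1) (block n f i) = block n f (i + 1)"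
      using l i by (intro smult_block) auto
    then show ?thesis using i by simp
  qed
  then show ?thesis
    using distinct_blocks[OF f] colored_labeling_blocks[OF f]
    by (auto simp: CR_ordered_def colored_partitions_def)
qed

section \<open>The word of a CR-ordered partition\<close>

lemma nth_partition_unique:
  assumes "distinct xs" "partition_on A (set xs)" "i < length xs" "j < length xs"
    "v \<in> xs ! i" "v \<in> xs ! j"
  shows "i = j"
proof -
  have "xs ! i = xs ! j"
    using disjointD[OF partition_onD2[OF assms(2)], of "xs ! i" "xs ! j"] assms by auto
  then show ?thesis using assms by (simp add: nth_eq_iff_index_eq)
qed

text \<open>The definition provides single steps inside a group. Iterating them from the first block
  of the group expresses all its blocks as translates of that one, and comparing two of them allows
  any \<open>c\<close>, including steps that wrap around.\<close>

lemma CR_translate: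
  assumes \<omega>: "\<omega> \<in> CR_ordered m n k" and j: "1 \<le> j" "j \<le> k * m"
    and "grp m j = grp m j'" "(j + c) mod m = j' mod m"
  shows "\<omega> ! j' = smult_set (zeta m ^ c) (\<omega> ! j)"
proof -
  have "grp m j \<in> {1..k}" unfolding grp_mem_iff using j by simp
  then obtain l where l: "grp m j = Suc l" "l < k" by (cases "grp m j") auto
  have lk: "l * m + m \<le> k * m" using l mult_le_mono1[of "Suc l" k m] by simp
  have step: "a < m \<Longrightarrow> \<omega> ! (l * m + 1 + a) = smult_set (zeta m ^ a) (\<omega> ! (l * m + 1))" for a
  proof (induction a)
    case (Suc a)
    have "\<not> m dvd l * m + (1 + a)"
      using Suc.prems dvd_add_right_iff[of m "l * m" "1 + a"] nat_dvd_not_less[of "1 + a" m] by simp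
    moreover have "l * m + 1 + a \<in> {1..<k * m}" using lk Suc.prems by auto
    ultimately have "\<omega> ! (l * m + 1 + a + 1) = smult_set (zeta m ^ 1) (\<omega> ! (l * m + 1 + a))"
      using \<omega> by (auto simp: CR_ordered_def add.assoc)
    then show ?case using Suc smult_set_smult_set[of 1 a] by simp
  qed simp
  have "l * m < j" "j \<le> l * m + m" "l * m < j'" "j' \<le> l * m + m"
    using l(1) assms(4) grp_eq_Suc_iff[of j l] grp_eq_Suc_iff[of j' l] by auto
  moreover define a b where "a = j - (l * m + 1)" "b = j' - (l * m + 1)"
  ultimately have ab: "a < m" "b < m" "j = l * m + 1 + a" "j' = l * m + 1 + b" by linarith+
  \<comment> \<open>The congruence between positions becomes an equality of powers, from which the
    common nonzero factor is cancelled.\<close>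
  have "zeta m ^ (l * m + 1) * zeta m ^ (c + a) = zeta m ^ (l * m + 1) * zeta m ^ b"
    using assms(5) unfolding power_add[symmetric] zeta_power_eq_iff ab by (simp add: ac_simps)
  then have "zeta m ^ (c + a) = zeta m ^ b" by simp
  then show ?thesis
    using step[OF ab(1)] step[OF ab(2)] ab smult_set_smult_set[of c a] by simp
qed

lemma CR_ordered_partition:
  assumes "\<omega> \<in> CR_ordered m n k"
  shows "length \<omega> = k * m + 1" "distinct \<omega>" "partition_on (ground m n) (set \<omega>)" "zero_vec \<in> \<omega> ! 0"
  using assms by (auto simp: CR_ordered_def colored_partitions_def colored_labeling_def)

text \<open>The closure condition is known for the zero block of some labeling \<open>B\<close> of
  the same partition. Both first blocks contain the zero vector, so they are equal.\<close>

lemma CR_zero_block_closed: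
  assumes \<omega>: "\<omega> \<in> CR_ordered m n k" and mem: "colored m i c \<in> \<omega> ! 0"
  shows "colored m i d \<in> \<omega> ! 0"
proof -
  note part = CR_ordered_partition[OF \<omega>]
  obtain B where B: "set \<omega> = set B" "colored_labeling m n k B"
    using \<omega> by (auto simp: CR_ordered_def colored_partitions_def)
  then have "zero_vec \<in> B ! 0" "B ! 0 \<in> set \<omega>"
    unfolding B(1) by (simp_all add: colored_labeling_def)
  moreover have "\<omega> ! 0 \<in> set \<omega>" using part(1) by simp
  ultimately have "B ! 0 = \<omega> ! 0"
    using disjointD[OF partition_onD2[OF part(3)], of "B ! 0" "\<omega> ! 0"] part(4) by blast
  moreover have "i \<in> {1..n}"
    using mem \<open>\<omega> ! 0 \<in> set \<omega>\<close> partition_onD1[OF part(3)] colored_mem_ground[of i c n] by blast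
  ultimately show ?thesis
    using B(2) mem unfolding colored_labeling_def all_colored_less ex_colored_less by blast
qed

text \<open>Let \<open>f i\<close> be the position of the color-0 element of base \<open>i\<close>.
  Each block of the word \<open>f\<close> lies inside the block of \<open>\<omega>\<close> at the
  same position; since the former cover the ground set and the latter are disjoint, they
  coincide.\<close>

lemma CR_ordered_obtain_word:
  assumes \<omega>: "\<omega> \<in> CR_ordered m n k"
  obtains f where "f \<in> words m n k" "\<omega> = blocks n k f"
proof -
  note part = CR_ordered_partition[OF \<omega>]
  have unique: "j = j'" if "v \<in> \<omega> ! j" "v \<in> \<omega> ! j'" "j \<le> k * m" "j' \<le> k * m" for v j j'
    using nth_partition_unique[OF part(2,3)] that part(1) by simp
  have covers: "\<exists>j\<le>k * m. v \<in> \<omega> ! j" if "v \<in> ground m n" for v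
    using partition_onD1[OF part(3)] that part(1)
    by (auto simp: in_set_conv_nth less_Suc_eq_le)
  have sub: "\<omega> ! j \<subseteq> ground m n" if "j \<le> k * m" for j
    using partition_onD1[OF part(3)] that part(1) nth_mem[of j \<omega>] by auto
  define f where "f i = (if i \<in> {1..n} then (SOME j. j \<le> k * m \<and> colored m i 0 \<in> \<omega> ! j) else 0)" for i
  have f: "f i \<le> k * m \<and> colored m i 0 \<in> \<omega> ! f i" if "i \<in> {1..n}" for i
  proof -
    have "\<exists>j. j \<le> k * m \<and> colored m i 0 \<in> \<omega> ! j" using covers[of "colored m i 0"] that by auto
    then show ?thesis using that someI_ex[of "\<lambda>j. j \<le> k * m \<and> colored m i 0 \<in> \<omega> ! j"]
      by (simp add: f_def)
  qed
  have f_le: "f i \<le> k * m" for i using f[of i] by (cases "i \<in> {1..n}") (auto simp: f_def)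
  have block_sub: "block n f j \<subseteq> \<omega> ! j" if j: "j \<le> k * m" for j
  proof
    fix v assume v: "v \<in> block n f j"
    then have "v \<in> ground m n" using block_subset_ground by blast
    then consider "v = zero_vec" | i c where "v = colored m i c" by (auto simp: mem_ground_iff)
    then show "v \<in> \<omega> ! j"
    proof cases
      case 1
      then show ?thesis using v part(4) by simp
    next
      case (2 i c)
      then have *: "i \<in> {1..n}" "grp m (f i) = grp m j" "j = 0 \<or> (f i + c) mod m = j mod m"
        using v by (auto simp: colored_mem_block)
      show ?thesis
      proof (cases "j = 0")
        case True
        then have "f i = 0" using *(2) by simp
        then show ?thesis using f[OF *(1)] True 2 CR_zero_block_closed[OF \<omega>] by auto
      next
        case False
        then have "grp m (f i) \<noteq> 0" using *(2) by simp
        then have "1 \<le> f i" by simp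
        then have "\<omega> ! j = smult_set (zeta m ^ c) (\<omega> ! f i)"
          using * False f_le by (intro CR_translate[OF \<omega>]) auto
        then show ?thesis
          using colored_mem_smult_set[of i c 0 "\<omega> ! f i"] f[OF *(1)] 2 by simp
      qed
    qed
  qed
  have eq: "\<omega> ! j = block n f j" if j: "j \<le> k * m" for j
  proof
    show "\<omega> ! j \<subseteq> block n f j"
    proof
      fix v assume v: "v \<in> \<omega> ! j"
      then have "v \<in> ground m n" using sub[OF j] by blast
      then obtain j' where j': "j' \<le> k * m" "v \<in> block n f j'" using block_covers[of f k, OF f_le] by blast
      then have "j' = j" using block_sub[OF j'(1)] unique[OF _ v] j by blast
      then show "v \<in> block n f j" using j' by simp
    qed
  qed (rule block_sub[OF j])
  have "{1..k} \<subseteq> range (grp m \<circ> f)"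
  proof
    fix g assume g: "g \<in> {1..k}"
    then have gm: "0 < g * m" "g * m \<le> k * m" using m_pos by auto
    then have "g * m < length \<omega>" using part(1) by linarith
    then have "\<omega> ! (g * m) \<in> set \<omega>" by (rule nth_mem)
    then have "\<omega> ! (g * m) \<noteq> {}" using partition_onD3[OF part(3)] by metis
    then obtain v where v: "v \<in> block n f (g * m)" using eq[OF gm(2)] by auto
    then show "g \<in> range (grp m \<circ> f)" using gm by (auto simp: block_def)
  qed
  then have "f \<in> words m n k" using f_le by (auto simp: words_def f_def)
  moreover have "\<omega> = blocks n k f"
    by (rule nth_equalityI) (use part(1) eq in \<open>auto simp: less_Suc_eq_le\<close>)
  ultimately show ?thesis using that by blast
qed

text \<open>\<open>f i\<close> is recovered as the position of the color-0 element of base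
  \<open>i\<close>.\<close>

lemma inj_on_blocks: "inj_on (blocks n k) (words m n k)"
proof (rule inj_onI)
  fix f f' assume f: "f \<in> words m n k" "f' \<in> words m n k" and eq: "blocks n k f = blocks n k f'"
  show "f = f'"
  proof
    fix i
    show "f i = f' i"
    proof (cases "i \<in> {1..n}")
      case True
      then have "colored m i 0 \<in> block n f (f i)" by (simp add: colored_mem_block)
      also have "block n f (f i) = block n f' (f i)"
        using eq words_le[OF f(1), of i] blocks_nth by metis
      finally have "colored m i 0 \<in> block n f' (f i)" .
      moreover have "colored m i 0 \<in> block n f' (f' i)" using True by (simp add: colored_mem_block)
      ultimately show ?thesis by (rule block_disjoint)
    next
      case False
      then show ?thesis using f words_0 by metis
    qed
  qed
qed

lemma bij_betw_blocks: "bij_betw (blocks n k) (words m n k) (CR_ordered m n k)"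
  unfolding bij_betw_def
proof
  show "blocks n k ` words m n k = CR_ordered m n k"
  proof
    show "CR_ordered m n k \<subseteq> blocks n k ` words m n k"
      by (blast elim: CR_ordered_obtain_word)
  qed (use blocks_CR_ordered in blast)
qed (rule inj_on_blocks)

section \<open>Minima, inversions and standard forms in terms of words\<close>

lemma minb_block:
  assumes "j > 0"
  shows "minb m (block n f j) = (LEAST i. i \<in> {1..n} \<and> grp m (f i) = grp m j)"
proof -
  \<comment> \<open>Every block of a nonzero group contains each base of the group in some color, so
    the minimum depends on the group alone.\<close>
  have "(\<exists>c<m. colored m i c \<in> block n f j) \<longleftrightarrow> i \<in> {1..n} \<and> grp m (f i) = grp m j" for i
  proof -
    obtain c where "(f i + c) mod m = j mod m" by (rule color_exists)
    then show ?thesis unfolding ex_colored_less unfolding colored_mem_block using assms by blast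
  qed
  then show ?thesis using assms by (simp add: minb_def)
qed

lemma minb_block_le_iff:
  assumes f: "f \<in> words m n k" and j: "0 < j" "j \<le> k * m" and "i \<le> n"
  shows "minb m (block n f j) \<le> i \<longleftrightarrow> grp m j \<in> (grp m \<circ> f) ` {1..i}"
proof -
  let ?P = "\<lambda>i. i \<in> {1..n} \<and> grp m (f i) = grp m j"
  have "grp m j \<in> {1..k}" unfolding grp_mem_iff using j by simp
  from words_hits[OF f this] have "\<exists>i. ?P i" by blast
  then have P: "?P (Least ?P)" by (rule LeastI_ex)
  show ?thesis unfolding minb_block[OF j(1)]
  proof
    assume "Least ?P \<le> i"
    then show "grp m j \<in> (grp m \<circ> f) ` {1..i}" using P by (auto intro!: rev_image_eqI[of "Least ?P"])
  next
    assume "grp m j \<in> (grp m \<circ> f) ` {1..i}"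
    then obtain i' where "?P i'" "i' \<le> i" using \<open>i \<le> n\<close> by auto
    then show "Least ?P \<le> i" using Least_le[of ?P i'] by linarith
  qed
qed

text \<open>In an inversion the position \<open>j\<close> is forced to be \<open>f i\<close>, and
  the blocks are distinct, so inversions correspond to pairs of a base \<open>i\<close> and a
  position \<open>l\<close>. By \<open>minb_block_le_iff\<close> these are the pairs that
  \<open>word_inv\<close> counts.\<close>

lemma inv_list_blocks:
  assumes f: "f \<in> words m n k"
  shows "inv_list m (blocks n k f) = word_inv m n k f"
proof -
  let ?L = "\<lambda>i. {l. f i < l \<and> l \<le> k * m \<and> grp m l \<in> (grp m \<circ> f) ` {1..i}}"
  let ?g = "\<lambda>(i, l). (colored m i 0, blocks n k f ! l)"
  have "inversions m (blocks n k f) = ?g ` (SIGMA i:{1..n}. ?L i)" (is "?A = ?B")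
  proof
    show "?A \<subseteq> ?B"
    proof
      fix x assume "x \<in> ?A"
      then obtain i j l where x: "x = (colored m i 0, blocks n k f ! l)" "j < l" "l \<le> k * m"
          "colored m i 0 \<in> block n f j" "minb m (block n f l) \<le> i"
        by (auto simp: inversions_def less_Suc_eq_le)
      then have i: "i \<in> {1..n}" by (simp add: colored_mem_block)
      then have "colored m i 0 \<in> block n f (f i)" by (simp add: colored_mem_block)
      then have "f i = j" using x(4) block_disjoint by blast
      then have "(i, l) \<in> (SIGMA i:{1..n}. ?L i)"
        using x i minb_block_le_iff[OF f, of l i] by auto
      then show "x \<in> ?B" using x(1) by force
    qed
    show "?B \<subseteq> ?A"
    proof
      fix x assume "x \<in> ?B"
      then obtain i l where x: "x = (colored m i 0, blocks n k f ! l)" "i \<in> {1..n}" "l \<in> ?L i"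
        by auto
      have "colored m i 0 \<in> blocks n k f ! f i"
        using x(2) words_le[OF f] by (simp add: colored_mem_block)
      moreover have "minb m (blocks n k f ! l) \<le> i"
        using x minb_block_le_iff[OF f, of l i] by auto
      moreover have "l < length (blocks n k f)" "f i < l" using x(3) by auto
      ultimately show "x \<in> ?A" using x(1) unfolding inversions_def by blast
    qed
  qed
  moreover have "inj_on ?g (SIGMA i:{1..n}. ?L i)"
    using distinct_blocks[OF f]
    by (auto simp: inj_on_def colored_eq_iff nth_eq_iff_index_eq less_Suc_eq_le simp del: blocks_nth)
  ultimately have "inv_list m (blocks n k f) = card (SIGMA i:{1..n}. ?L i)"
    by (simp only: inv_list_def card_image)
  also have "\<dots> = (\<Sum>i\<in>{1..n}. card (?L i))"
  proof (rule card_SigmaI)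
    have "finite (?L i)" for i by (rule finite_subset[of _ "{..k * m}"]) auto
    then show "\<forall>i\<in>{1..n}. finite (?L i)" by simp
  qed simp
  also have "\<dots> = word_inv m n k f" by (simp only: word_inv_def)
  finally show ?thesis .
qed

text \<open>Let \<open>M g\<close> be the smallest base in group \<open>g\<close>. A standard form
  requires \<open>M\<close> to increase strictly and \<open>f (M g)\<close> to be a multiple of
  \<open>m\<close>. Since \<open>M g\<close> is the base that opens group \<open>g\<close>, this is
  what \<open>fresh_ok\<close> demands base by base.\<close>

lemma standard_form_blocks_iff:
  assumes f: "f \<in> words m n k"
  shows "standard_form m n k (blocks n k f) \<longleftrightarrow> f \<in> std_words m n k"
proof -
  \<comment> \<open>The value 0 at group 0 agrees with \<open>minb\<close> on the zero block and
    lies below every base.\<close>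
  define M where "M g = (if g = 0 then 0 else LEAST i. i \<in> {1..n} \<and> grp m (f i) = g)" for g
  have minb_M: "minb m (block n f j) = M (grp m j)" for j
    using minb_block[of j n f] by (cases "j = 0") (auto simp: M_def minb_def)
  have M: "M g \<in> {1..n} \<and> grp m (f (M g)) = g" if "g \<in> {1..k}" for g
  proof -
    have "\<exists>i. i \<in> {1..n} \<and> grp m (f i) = g" using words_hits[OF f that] by blast
    from LeastI_ex[OF this] show ?thesis using that by (auto simp: M_def simp del: grp_eq_0_iff)
  qed
  have M_le: "M (grp m (f i)) \<le> i" if "i \<in> {1..n}" for i
    using that by (auto simp: M_def intro!: Least_le)
  have lm: "l * m \<le> k * m" if "l \<le> k" for l using that by simp
  have "standard_form m n k (blocks n k f) \<longleftrightarrow>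
      (\<forall>l<k. M l < M (Suc l)) \<and> (\<forall>j\<in>{1..k * m}. m dvd f (M (grp m j)))"
  proof -
    have "minb m (blocks n k f ! (l * m)) < minb m (blocks n k f ! ((l + 1) * m)) \<longleftrightarrow> M l < M (Suc l)"
      if "l < k" for l
    proof -
      have "l * m \<le> k * m" "Suc l * m \<le> k * m" using that by (intro lm; simp)+
      then show ?thesis
        by (simp add: minb_M del: mult_Suc)
    qed
    \<comment> \<open>Color \<open>j\<close> at position \<open>j\<close> of the group means that
      \<open>f (M g) + j\<close> and \<open>j\<close> agree modulo \<open>m\<close>.\<close>
    moreover have "colored m (minb m (blocks n k f ! j)) (j mod m) \<in> blocks n k f ! j \<longleftrightarrow>
        m dvd f (M (grp m j))" if "j \<in> {1..k * m}" for j
    proof -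
      have "grp m j \<in> {1..k}" unfolding grp_mem_iff using that by simp
      from M[OF this] show ?thesis
        using that by (simp add: minb_M colored_mem_block mod_add_self_iff)
    qed
    moreover have "minb m (blocks n k f ! 0) = 0" by (simp add: minb_def)
    ultimately show ?thesis
      using colored_labeling_blocks[OF f] unfolding standard_form_def by blast
  qed
  also have "\<dots> \<longleftrightarrow> f \<in> std_words m n k"
  proof
    assume std: "(\<forall>l<k. M l < M (Suc l)) \<and> (\<forall>j\<in>{1..k * m}. m dvd f (M (grp m j)))"
    have M_mono: "a < b \<Longrightarrow> b \<le> k \<Longrightarrow> M a < M b" for a b
    proof (induction b)
      case (Suc b)
      have "M b < M (Suc b)" using std Suc.prems by simp
      then show ?case using Suc by (cases "a = b") auto
    qed simp
    have "fresh_ok m f i" if i: "i \<in> {1..n}" for i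
      unfolding fresh_ok_def
    proof (intro impI)
      assume fi: "f i \<noteq> 0" "grp m (f i) \<notin> (grp m \<circ> f) ` {1..<i}"
      have g: "grp m (f i) \<in> {1..k}" unfolding grp_mem_iff using fi words_le[OF f] by simp
      \<comment> \<open>A base whose group no smaller base has met is the minimum of that
        group.\<close>
      have "\<not> M (grp m (f i)) < i"
      proof
        assume "M (grp m (f i)) < i"
        then have "M (grp m (f i)) \<in> {1..<i}" using M[OF g] by auto
        then show False using fi(2) M[OF g] by (metis comp_apply image_eqI)
      qed
      then have iM: "M (grp m (f i)) = i" using M_le[OF i] by linarith
      have "f i \<in> {1..k * m}" using fi words_le[OF f] by auto
      then have "m dvd f i" using std iM by metis
      moreover have "{1..<grp m (f i)} \<subseteq> (grp m \<circ> f) ` {1..<i}"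
      proof
        fix g' assume g': "g' \<in> {1..<grp m (f i)}"
        then have "g' \<in> {1..k}" using g by auto
        moreover have "M g' < i" using M_mono[of g' "grp m (f i)"] g' g iM by simp
        ultimately have "M g' \<in> {1..<i}" "grp m (f (M g')) = g'" using M[of g'] by auto
        then show "g' \<in> (grp m \<circ> f) ` {1..<i}" by (metis comp_apply image_eqI)
      qed
      ultimately show "m dvd f i \<and> {1..<grp m (f i)} \<subseteq> (grp m \<circ> f) ` {1..<i}" by blast
    qed
    then show "f \<in> std_words m n k" using f by (simp add: std_words_def)
  next
    assume std: "f \<in> std_words m n k"
    have *: "m dvd f (M g) \<and> {1..<g} \<subseteq> (grp m \<circ> f) ` {1..<M g}" if g: "g \<in> {1..k}" for g
    proof -
      have "fresh_ok m f (M g)" using M[OF g] std by (simp add: std_words_def)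
      moreover have "f (M g) \<noteq> 0"
      proof
        assume "f (M g) = 0"
        then show False using M[OF g] g by simp
      qed
      moreover have "g \<notin> (grp m \<circ> f) ` {1..<M g}"
      proof
        assume "g \<in> (grp m \<circ> f) ` {1..<M g}"
        then obtain i where i: "i \<in> {1..<M g}" "grp m (f i) = g" by auto
        then have "i \<in> {1..n}" using M[OF g] by auto
        from M_le[OF this] i show False by simp
      qed
      ultimately show ?thesis using M[OF g] unfolding fresh_ok_def by simp
    qed
    have "M l < M (Suc l)" if "l < k" for l
    proof (cases "l = 0")
      case True
      then show ?thesis using M[of "Suc 0"] that by (auto simp: M_def[of 0])
    next
      case False
      then have "l \<in> {1..<Suc l}" by simp
      moreover have "Suc l \<in> {1..k}" using that by simp
      ultimately have "l \<in> (grp m \<circ> f) ` {1..<M (Suc l)}" using *[of "Suc l"] by blast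
      then obtain i where i: "i \<in> {1..<M (Suc l)}" "grp m (f i) = l" by auto
      then have "i \<in> {1..n}" using M[OF \<open>Suc l \<in> {1..k}\<close>] by auto
      from M_le[OF this] i show ?thesis by simp
    qed
    moreover have "m dvd f (M (grp m j))" if "j \<in> {1..k * m}" for j
    proof -
      have "grp m j \<in> {1..k}" unfolding grp_mem_iff using that by simp
      then show ?thesis using * by blast
    qed
    ultimately show "(\<forall>l<k. M l < M (Suc l)) \<and> (\<forall>j\<in>{1..k * m}. m dvd f (M (grp m j)))" by blast
  qed
  finally show ?thesis .
qed

section \<open>Standard forms\<close>

lemma colored_mem_smult_set_mod:
  assumes "d mod m = (a + c) mod m" "colored m i c \<in> S"
  shows "colored m i d \<in> smult_set (zeta m ^ a) S"
proof -
  have "colored m i d = colored m i (a + c)" using assms(1) by (simp add: colored_eq_iff)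
  then show ?thesis using assms(2) by (simp add: colored_mem_smult_set)
qed

lemma minb_smult_set: "minb m (smult_set (zeta m ^ a) S) = minb m S"
proof -
  have "(\<exists>c. colored m i c \<in> smult_set (zeta m ^ a) S) \<longleftrightarrow> (\<exists>c. colored m i c \<in> S)" for i
  proof
    assume "\<exists>c. colored m i c \<in> smult_set (zeta m ^ a) S"
    then obtain c where c: "colored m i c \<in> smult_set (zeta m ^ a) S" by blast
    obtain d where "(a + d) mod m = c mod m" by (rule color_exists)
    then have "colored m i (a + d) = colored m i c" by (simp add: colored_eq_iff)
    then have "colored m i (a + d) \<in> smult_set (zeta m ^ a) S" using c by simp
    then show "\<exists>c. colored m i c \<in> S" unfolding colored_mem_smult_set by blast
  next
    assume "\<exists>c. colored m i c \<in> S"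
    then show "\<exists>c. colored m i c \<in> smult_set (zeta m ^ a) S"
      using colored_mem_smult_set by blast
  qed
  then show ?thesis by (simp add: minb_def zero_mem_smult_set ex_colored_less)
qed

section \<open>Arbitrary labelings of a colored set partition, with groups as orbits under
  multiplication by \<open>zeta m\<close>\<close>

context
  fixes n k :: nat and B :: "cvec set list"
  assumes lab: "colored_labeling m n k B"
begin

lemma labeling_partition:
  "length B = k * m + 1" "distinct B" "partition_on (ground m n) (set B)" "zero_vec \<in> B ! 0"
  using lab by (simp_all add: colored_labeling_def)

lemma labeling_unique:
  "v \<in> B ! j \<Longrightarrow> v \<in> B ! j' \<Longrightarrow> j \<le> k * m \<Longrightarrow> j' \<le> k * m \<Longrightarrow> j = j'"
  using nth_partition_unique[OF labeling_partition(2,3)] labeling_partition(1) by simp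

lemma labeling_subset_ground: "j \<le> k * m \<Longrightarrow> B ! j \<subseteq> ground m n"
  using partition_onD1[OF labeling_partition(3)] labeling_partition(1) nth_mem[of j B] by auto

text \<open>The definition equates two sets of blocks. As the group holds \<open>m\<close> distinct
  blocks, counting shows that the \<open>m\<close> translates of \<open>S\<close> are pairwise
  distinct.\<close>

lemma labeling_orbit:
  assumes "l < k"
  obtains S where "(\<lambda>j. B ! j) ` {j. grp m j = Suc l} = (\<lambda>c. smult_set (zeta m ^ c) S) ` {..<m}"
    "inj_on (\<lambda>c. smult_set (zeta m ^ c) S) {..<m}"
proof -
  have group: "{l * m + 1..(l + 1) * m} = {j. grp m j = Suc l}"
    by (auto simp: grp_eq_Suc_iff)
  obtain S where S: "(\<lambda>j. B ! j) ` {j. grp m j = Suc l} = (\<lambda>c. smult_set (zeta m ^ c) S) ` {..<m}"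
  proof -
    have "\<forall>l<k. \<exists>S. (\<lambda>j. B ! j) ` {l * m + 1..(l + 1) * m} = (\<lambda>c. smult_set (zeta m ^ c) S) ` {..<m}"
      using lab unfolding colored_labeling_def by (elim conjE)
    from this[rule_format, OF assms] show ?thesis using that unfolding group by (elim exE)
  qed
  have lk: "Suc l * m \<le> k * m" using assms by (intro mult_le_mono1) simp
  have "inj_on (\<lambda>j. B ! j) {l * m + 1..(l + 1) * m}"
    using labeling_partition(1,2) lk by (auto simp: inj_on_def nth_eq_iff_index_eq)
  then have "card ((\<lambda>j. B ! j) ` {j. grp m j = Suc l}) = m"
    unfolding group[symmetric] by (simp add: card_image)
  then have "inj_on (\<lambda>c. smult_set (zeta m ^ c) S) {..<m}"
    unfolding S by (intro eq_card_imp_inj_on) simp_all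
  then show ?thesis using S that by blast
qed

lemma labeling_orbit_at:
  assumes "j \<in> {1..k * m}"
  obtains S a where "(\<lambda>j. B ! j) ` {j'. grp m j' = grp m j} = (\<lambda>c. smult_set (zeta m ^ c) S) ` {..<m}"
    "inj_on (\<lambda>c. smult_set (zeta m ^ c) S) {..<m}" "B ! j = smult_set (zeta m ^ a) S"
proof -
  have "grp m j \<in> {1..k}" unfolding grp_mem_iff using assms by simp
  then obtain l where l: "grp m j = Suc l" "l < k" by (cases "grp m j") auto
  obtain S where S: "(\<lambda>j. B ! j) ` {j. grp m j = Suc l} = (\<lambda>c. smult_set (zeta m ^ c) S) ` {..<m}"
    "inj_on (\<lambda>c. smult_set (zeta m ^ c) S) {..<m}"
    using labeling_orbit[OF l(2)] by blast
  have "B ! j \<in> (\<lambda>c. smult_set (zeta m ^ c) S) ` {..<m}"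
    unfolding S(1)[symmetric] using l by blast
  then show ?thesis using that S l by auto
qed

text \<open>A group is a full orbit, so a translate of one of its blocks is again a block of the
  same group.\<close>

lemma labeling_smult:
  assumes j: "j \<in> {1..k * m}"
  obtains j' where "grp m j' = grp m j" "j' \<in> {1..k * m}" "B ! j' = smult_set (zeta m ^ c) (B ! j)"
proof -
  obtain S a where S: "(\<lambda>j. B ! j) ` {j'. grp m j' = grp m j} = (\<lambda>c. smult_set (zeta m ^ c) S) ` {..<m}"
    "inj_on (\<lambda>c. smult_set (zeta m ^ c) S) {..<m}" "B ! j = smult_set (zeta m ^ a) S"
    by (rule labeling_orbit_at[OF j])
  have "smult_set (zeta m ^ c) (B ! j) = smult_set (zeta m ^ ((c + a) mod m)) S"
    unfolding S(3) smult_set_smult_set by (intro smult_set_cong) simp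
  moreover have "(c + a) mod m < m" using m_pos by simp
  ultimately have "smult_set (zeta m ^ c) (B ! j) \<in> (\<lambda>j. B ! j) ` {j'. grp m j' = grp m j}"
    unfolding S(1) by blast
  then obtain j' where j': "grp m j' = grp m j" "B ! j' = smult_set (zeta m ^ c) (B ! j)"
    by auto
  moreover have "j' \<in> {1..k * m}"
    using j'(1) j grp_mem_iff[of j k] grp_mem_iff[of j' k] by simp
  ultimately show ?thesis using that by blast
qed

lemma labeling_translate:
  assumes "j \<in> {1..k * m}" "grp m j' = grp m j"
  obtains c where "B ! j' = smult_set (zeta m ^ c) (B ! j)"
proof -
  obtain S a where S: "(\<lambda>j. B ! j) ` {j'. grp m j' = grp m j} = (\<lambda>c. smult_set (zeta m ^ c) S) ` {..<m}"
    "inj_on (\<lambda>c. smult_set (zeta m ^ c) S) {..<m}" "B ! j = smult_set (zeta m ^ a) S"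
    by (rule labeling_orbit_at[OF assms(1)])
  have "B ! j' \<in> (\<lambda>c. smult_set (zeta m ^ c) S) ` {..<m}"
    unfolding S(1)[symmetric] using assms(2) by blast
  then obtain b where b: "B ! j' = smult_set (zeta m ^ b) S" by blast
  obtain c where "(a + c) mod m = b mod m" by (rule color_exists)
  then have "B ! j' = smult_set (zeta m ^ c) (B ! j)"
    unfolding S(3) b smult_set_smult_set by (intro smult_set_cong) (simp add: add.commute)
  then show ?thesis using that by blast
qed

text \<open>The translate of the block by the difference \<open>e\<close> of the colors shares an
  element with the block and hence equals it. As the \<open>m\<close> translates are distinct,
  \<open>e\<close> is 0 modulo \<open>m\<close>.\<close>

lemma labeling_color_unique:
  assumes j: "j \<in> {1..k * m}" and mem: "colored m i c \<in> B ! j" "colored m i d \<in> B ! j"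
  shows "c mod m = d mod m"
proof -
  obtain S a where "(\<lambda>j. B ! j) ` {j'. grp m j' = grp m j} = (\<lambda>c. smult_set (zeta m ^ c) S) ` {..<m}"
    and inj: "inj_on (\<lambda>c. smult_set (zeta m ^ c) S) {..<m}"
    and a: "B ! j = smult_set (zeta m ^ a) S"
    by (rule labeling_orbit_at[OF j])
  obtain e where e: "(c + e) mod m = d mod m" by (rule color_exists)
  obtain j' where j': "j' \<in> {1..k * m}" "B ! j' = smult_set (zeta m ^ e) (B ! j)"
    using labeling_smult[OF j] by blast
  have "colored m i d \<in> B ! j'"
    unfolding j'(2) using e mem(1) by (intro colored_mem_smult_set_mod) (simp_all add: add.commute)
  then have "j' = j" using labeling_unique mem(2) j j'(1) by simp
  then have "smult_set (zeta m ^ (e + a)) S = smult_set (zeta m ^ a) S"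
    using j'(2) a smult_set_smult_set by simp
  then have "smult_set (zeta m ^ ((e + a) mod m)) S = smult_set (zeta m ^ (a mod m)) S"
    using smult_set_cong[of "(e + a) mod m" "e + a" S] smult_set_cong[of "a mod m" a S] by simp
  then have "(e + a) mod m = a mod m" using inj m_pos by (auto dest: inj_onD)
  then have "m dvd e" by (simp add: mod_add_self_iff)
  then show ?thesis using e by (metis add.commute mod_add_self_iff)
qed

lemma labeling_no_zero: "j \<in> {1..k * m} \<Longrightarrow> zero_vec \<notin> B ! j"
  using labeling_unique[OF _ labeling_partition(4), of j] by auto

lemma labeling_minb:
  assumes j: "j \<in> {1..k * m}"
  shows "\<exists>c. colored m (minb m (B ! j)) c \<in> B ! j" "minb m (B ! j) \<in> {1..n}"
proof -
  have "B ! j \<in> set B" using j labeling_partition(1) by simp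
  then have "B ! j \<noteq> {}" using partition_onD3[OF labeling_partition(3)] by metis
  then obtain v where "v \<in> B ! j" by blast
  moreover from this have "v \<in> ground m n" using labeling_subset_ground[of j] j by auto
  moreover have "v \<noteq> zero_vec" using \<open>v \<in> B ! j\<close> labeling_no_zero[OF j] by blast
  ultimately obtain i c where "colored m i c \<in> B ! j" by (auto simp: mem_ground_iff)
  then have "\<exists>i c. colored m i c \<in> B ! j" by blast
  from LeastI_ex[OF this] show *: "\<exists>c. colored m (minb m (B ! j)) c \<in> B ! j"
    using labeling_no_zero[OF j] by (simp add: minb_def ex_colored_less)
  then obtain c where "colored m (minb m (B ! j)) c \<in> ground m n"
    using labeling_subset_ground[of j] j by auto
  then show "minb m (B ! j) \<in> {1..n}" by (simp only: colored_mem_ground)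
qed

lemma labeling_minb_group:
  assumes "j \<in> {1..k * m}" "grp m j' = grp m j"
  shows "minb m (B ! j') = minb m (B ! j)"
  using labeling_translate[OF assms] minb_smult_set by metis

lemma labeling_minb_color:
  assumes j: "j \<in> {1..k * m}"
  obtains j' where "j' \<in> {1..k * m}" "grp m j' = grp m j" "colored m (minb m (B ! j)) c \<in> B ! j'"
proof -
  obtain d where d: "colored m (minb m (B ! j)) d \<in> B ! j" using labeling_minb[OF j] by blast
  obtain e where e: "(d + e) mod m = c mod m" by (rule color_exists)
  obtain j' where j': "grp m j' = grp m j" "j' \<in> {1..k * m}" "B ! j' = smult_set (zeta m ^ e) (B ! j)"
    using labeling_smult[OF j] by blast
  have "colored m (minb m (B ! j)) c \<in> B ! j'"
    unfolding j'(3) using e d by (intro colored_mem_smult_set_mod) (simp_all add: add.commute)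
  then show ?thesis using that j' by blast
qed

text \<open>The minimal base of a group occurs there in every color. Two groups with the same
  minimal base therefore share an element, hence a block.\<close>

lemma labeling_minb_inj:
  assumes j: "j \<in> {1..k * m}" "j' \<in> {1..k * m}" and eq: "minb m (B ! j) = minb m (B ! j')"
  shows "grp m j = grp m j'"
proof -
  obtain d where d: "colored m (minb m (B ! j)) d \<in> B ! j" using labeling_minb[OF j(1)] by blast
  obtain j'' where j'': "j'' \<in> {1..k * m}" "grp m j'' = grp m j'" "colored m (minb m (B ! j')) d \<in> B ! j''"
    using labeling_minb_color[OF j(2)] by blast
  then have "j'' = j" using labeling_unique[of _ j'' j] d j(1) unfolding eq by simp
  then show ?thesis using j'' by simp
qed

text \<open>The left side depends on the partition alone, the right side reads one minimum per group
  from the labeling. This lets different labelings of one partition be compared.\<close>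

lemma labeling_mins:
  "minb m ` {S \<in> set B. zero_vec \<notin> S} = (\<lambda>l. minb m (B ! (Suc l * m))) ` {..<k}"
proof -
  have *: "Suc l * m \<in> {1..k * m}" if "l < k" for l
    using that m_pos mult_le_mono1[of "Suc l" k m] by simp
  show ?thesis
  proof
    show "(\<lambda>l. minb m (B ! (Suc l * m))) ` {..<k} \<subseteq> minb m ` {S \<in> set B. zero_vec \<notin> S}"
    proof
      fix t assume "t \<in> (\<lambda>l. minb m (B ! (Suc l * m))) ` {..<k}"
      then obtain l where l: "l < k" "t = minb m (B ! (Suc l * m))" by auto
      have "B ! (Suc l * m) \<in> set B" using *[OF l(1)] labeling_partition(1) by (intro nth_mem) simp
      then show "t \<in> minb m ` {S \<in> set B. zero_vec \<notin> S}"
        using labeling_no_zero[OF *[OF l(1)]] l(2) by blast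
    qed
    show "minb m ` {S \<in> set B. zero_vec \<notin> S} \<subseteq> (\<lambda>l. minb m (B ! (Suc l * m))) ` {..<k}"
    proof
      fix t assume "t \<in> minb m ` {S \<in> set B. zero_vec \<notin> S}"
      then obtain j where j: "j < length B" "zero_vec \<notin> B ! j" "t = minb m (B ! j)"
        by (auto simp: in_set_conv_nth)
      then have "j \<noteq> 0" using labeling_partition(4) by metis
      then have j1: "j \<in> {1..k * m}" using j(1) labeling_partition(1) by simp
      then have "grp m j \<in> {1..k}" unfolding grp_mem_iff by simp
      then obtain l where l: "grp m j = Suc l" "l < k" by (cases "grp m j") auto
      have "t = minb m (B ! (Suc l * m))"
        using labeling_minb_group[OF j1, of "Suc l * m"] l(1) j(3) by (simp del: mult_Suc)
      then show "t \<in> (\<lambda>l. minb m (B ! (Suc l * m))) ` {..<k}" using l(2) by blast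
    qed
  qed
qed

lemma card_labeling_mins: "card (minb m ` {S \<in> set B. zero_vec \<notin> S}) = k"
proof -
  have *: "Suc l * m \<in> {1..k * m}" if "l < k" for l
    using that m_pos mult_le_mono1[of "Suc l" k m] by simp
  have "inj_on (\<lambda>l. minb m (B ! (Suc l * m))) {..<k}"
  proof (rule inj_onI)
    fix l l' assume l: "l \<in> {..<k}" "l' \<in> {..<k}" and eq: "minb m (B ! (Suc l * m)) = minb m (B ! (Suc l' * m))"
    have "grp m (Suc l * m) = grp m (Suc l' * m)"
      using labeling_minb_inj[OF * * eq] l by blast
    then show "l = l'" by (simp del: mult_Suc)
  qed
  then show ?thesis unfolding labeling_mins by (simp add: card_image)
qed

text \<open>With \<open>t\<close> the increasing enumeration of the minima of the groups, position \<open>j\<close> has to hold the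
  block containing the element of base \<open>t j\<close> and color \<open>j\<close>.\<close>

lemma ex_standard_form: "\<exists>C. standard_form m n k C \<and> set C = set B"
proof -
  let ?T = "minb m ` {S \<in> set B. zero_vec \<notin> S}"
  define ts where "ts = sorted_list_of_set ?T"
  have finT: "finite ?T" by simp
  have ts: "set ts = ?T" "sorted_wrt (<) ts" "length ts = k" "distinct ts"
    unfolding ts_def using finT card_labeling_mins by (simp_all add: strict_sorted_list_of_set)
  \<comment> \<open>Groups are numbered from 1 and list entries from 0.\<close>
  define t where "t j = ts ! (grp m j - 1)" for j
  have t_mem: "\<exists>j'\<in>{1..k * m}. t j = minb m (B ! j')" if "j \<in> {1..k * m}" for j
  proof -
    have "grp m j \<in> {1..k}" unfolding grp_mem_iff using that by simp
    then have "t j \<in> ?T" unfolding t_def ts(1)[symmetric] using ts(3) by (intro nth_mem) auto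
    then obtain l where "l < k" "t j = minb m (B ! (Suc l * m))" unfolding labeling_mins by auto
    moreover have "Suc l * m \<in> {1..k * m}"
      using \<open>l < k\<close> m_pos mult_le_mono1[of "Suc l" k m] by simp
    ultimately show ?thesis by blast
  qed
  have "\<exists>j'\<in>{1..k * m}. colored m (t j) j \<in> B ! j' \<and> minb m (B ! j') = t j"
    if j: "j \<in> {1..k * m}" for j
  proof -
    obtain a where a: "a \<in> {1..k * m}" "t j = minb m (B ! a)" using t_mem[OF j] by blast
    obtain b where b: "b \<in> {1..k * m}" "grp m b = grp m a" "colored m (minb m (B ! a)) j \<in> B ! b"
      using labeling_minb_color[OF a(1)] by blast
    then show ?thesis using labeling_minb_group[OF a(1) b(2)] a(2) by auto
  qed
  then obtain p0 where p0: "p0 j \<in> {1..k * m}" "colored m (t j) j \<in> B ! p0 j" "minb m (B ! p0 j) = t j"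
    if "j \<in> {1..k * m}" for j by metis
  define p where "p j = (if j = 0 then 0 else p0 j)" for j
  have p: "p j \<in> {1..k * m}" "colored m (t j) j \<in> B ! p j" "minb m (B ! p j) = t j"
    if "j \<in> {1..k * m}" for j using p0[OF that] that by (auto simp: p_def)
  have p_0 [simp]: "p 0 = 0" by (simp add: p_def)
  have p_group: "grp m j = grp m j'" if j: "j \<in> {1..k * m}" "j' \<in> {1..k * m}" "t j = t j'" for j j'
  proof -
    have "grp m j \<in> {1..k}" "grp m j' \<in> {1..k}" unfolding grp_mem_iff using j by simp_all
    then show ?thesis
      using j(3) ts(3,4) unfolding t_def by (auto simp: nth_eq_iff_index_eq simp del: grp_eq_0_iff)
  qed
  have p_le: "p j \<le> k * m" if "j \<le> k * m" for j
    using p(1)[of j] that by (cases "j = 0") auto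
  \<comment> \<open>If \<open>p j = p j'\<close>, the block minimum \<open>t j = t j'\<close> fixes
    the group, and the only color of this base in the block fixes the residue.\<close>
  have p_inj: "inj_on p {..k * m}"
  proof (rule inj_onI)
    fix j j' assume j: "j \<in> {..k * m}" "j' \<in> {..k * m}" and eq: "p j = p j'"
    show "j = j'"
    proof (cases "j = 0 \<or> j' = 0")
      case True
      then show ?thesis using eq p(1)[of j] p(1)[of j'] j by (cases "j = 0"; cases "j' = 0") auto
    next
      case False
      then have j1: "j \<in> {1..k * m}" "j' \<in> {1..k * m}" using j by auto
      then have "t j = t j'" using p(3) eq by metis
      then have "grp m j = grp m j'" using p_group j1 by blast
      moreover have "j mod m = j' mod m"
        using p(2)[OF j1(1)] p(2)[OF j1(2)] \<open>t j = t j'\<close> eq labeling_color_unique[OF p(1)[OF j1(1)]]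
        by metis
      ultimately show ?thesis by (rule grp_mod_unique)
    qed
  qed
  have p_surj: "p ` {..k * m} = {..k * m}"
    using p_le p_inj by (intro endo_inj_surj) auto
  define C where "C = map (\<lambda>j. B ! p j) [0..<k * m + 1]"
  have C_nth: "C ! j = B ! p j" if "j \<le> k * m" for j
    using that by (simp add: C_def del: upt_Suc)
  have lenC: "length C = k * m + 1" by (simp add: C_def)
  have "set C = (\<lambda>j. B ! j) ` (p ` {..k * m})"
    by (auto simp: C_def simp del: upt_Suc)
  also have "\<dots> = set B" unfolding p_surj set_conv_nth labeling_partition(1)
    by (auto simp: less_Suc_eq_le)
  finally have setC: "set C = set B" .
  have "card (set C) = length C"
    unfolding setC lenC using distinct_card[OF labeling_partition(2)] labeling_partition(1) by simp
  then have distC: "distinct C" by (rule card_distinct)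
  have labC: "colored_labeling m n k C"
    unfolding colored_labeling_def
  proof (intro conjI allI impI)
    show "partition_on (ground m n) (set C)" unfolding setC by (rule labeling_partition(3))
    show "zero_vec \<in> C ! 0" using C_nth[of 0] labeling_partition(4) by simp
    show "\<forall>i\<in>{1..n}. (\<exists>c<m. colored m i c \<in> C ! 0) \<longrightarrow> (\<forall>d<m. colored m i d \<in> C ! 0)"
      using C_nth[of 0] lab by (simp add: colored_labeling_def)
    fix l assume l: "l < k"
    have lk: "l * m + m \<le> k * m" using l mult_le_mono1[of "Suc l" k m] by simp
    let ?S = "C ! (l * m + 1)"
    have "C ! (l * m + 1 + c) = smult_set (zeta m ^ c) ?S" if c: "c < m" for c
    proof -
      let ?j = "l * m + 1" and ?j' = "l * m + 1 + c"
      have j: "?j \<in> {1..k * m}" "?j' \<in> {1..k * m}" using lk c by auto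
      have "grp m ?j = Suc l" "grp m ?j' = Suc l" using c unfolding grp_eq_Suc_iff by auto
      then have "t ?j' = t ?j" by (simp add: t_def)
      \<comment> \<open>The translate of the first block of the group contains base
        \<open>t ?j\<close> in color \<open>?j'\<close>, and so does the block chosen for
        \<open>?j'\<close>; an element lies in one block only.\<close>
      obtain j'' where j'': "j'' \<in> {1..k * m}" "B ! j'' = smult_set (zeta m ^ c) (B ! p ?j)"
        using labeling_smult[OF p(1)[OF j(1)]] by blast
      have "colored m (t ?j) ?j' \<in> B ! j''"
        unfolding j''(2) using p(2)[OF j(1)] by (intro colored_mem_smult_set_mod[of _ _ ?j]) (simp_all add: ac_simps)
      moreover have "colored m (t ?j) ?j' \<in> B ! p ?j'" using p(2)[OF j(2)] \<open>t ?j' = t ?j\<close> by simp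
      ultimately have "j'' = p ?j'" using labeling_unique j''(1) p(1)[OF j(2)] by simp
      then show ?thesis using j''(2) C_nth[of ?j] C_nth[of ?j'] j by simp
    qed
    then have "(\<lambda>j. C ! j) ` {l * m + 1..(l + 1) * m} = (\<lambda>c. smult_set (zeta m ^ c) ?S) ` {..<m}"
      unfolding group_interval image_image by (intro image_cong) simp_all
    then show "\<exists>S. (\<lambda>j. C ! j) ` {l * m + 1..(l + 1) * m} = (\<lambda>c. smult_set (zeta m ^ c) S) ` {..<m}"
      by blast
  qed (use lenC distC in auto)
  have minbC: "minb m (C ! j) = t j" if "j \<in> {1..k * m}" for j
    using p(3)[OF that] C_nth[of j] that by simp
  have "minb m (C ! (l * m)) < minb m (C ! ((l + 1) * m))" if l: "l < k" for l
  proof -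
    have l1: "Suc l * m \<in> {1..k * m}" using l m_pos mult_le_mono1[of "Suc l" k m] by simp
    have t1: "t (Suc l * m) = ts ! l" unfolding t_def grp_mult by simp
    show ?thesis
    proof (cases l)
      case 0
      have "minb m (C ! 0) = 0" using C_nth[of 0] labeling_partition(4) by (simp add: minb_def)
      moreover have "t (Suc l * m) \<in> {1..n}"
        using labeling_minb(2)[OF p(1)[OF l1]] unfolding p(3)[OF l1] .
      ultimately show ?thesis using minbC[OF l1] 0 by simp
    next
      case (Suc l')
      have l2: "l * m \<in> {1..k * m}" using l m_pos Suc mult_le_mono1[of l k m] by simp
      have "t (l * m) = ts ! l'" unfolding t_def grp_mult Suc by simp
      moreover have "ts ! l' < ts ! l" using ts(2,3) l Suc by (simp add: sorted_wrt_nth_less)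
      ultimately show ?thesis using minbC[OF l1] minbC[OF l2] t1 by simp
    qed
  qed
  moreover have "colored m (minb m (C ! j)) (j mod m) \<in> C ! j" if j: "j \<in> {1..k * m}" for j
    using minbC[OF j] p(2)[OF j] C_nth[of j] j by simp
  moreover have "minb m (C ! 0) = 0" using C_nth[of 0] labeling_partition(4) by (simp add: minb_def)
  ultimately have "standard_form m n k C" using labC unfolding standard_form_def by blast
  then show ?thesis using setC by blast
qed

end

text \<open>The block minima of a standard form are increasing, so they are determined by the partition.\<close>

lemma standard_form_sorted_mins:
  assumes "standard_form m n k C"
  shows "map (\<lambda>l. minb m (C ! (Suc l * m))) [0..<k] = sorted_list_of_set (minb m ` {S \<in> set C. zero_vec \<notin> S})"
proof -
  have lab: "colored_labeling m n k C" and "\<forall>l<k. minb m (C ! (l * m)) < minb m (C ! ((l + 1) * m))"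
    using assms by (auto simp: standard_form_def)
  let ?M = "\<lambda>l. minb m (C ! (l * m))"
  have mono: "a < b \<Longrightarrow> b \<le> k \<Longrightarrow> ?M a < ?M b" for a b
  proof (induction b)
    case (Suc b)
    have "?M b < ?M (Suc b)"
      using \<open>\<forall>l<k. minb m (C ! (l * m)) < minb m (C ! ((l + 1) * m))\<close> Suc.prems by simp
    then show ?case using Suc by (cases "a = b") auto
  qed simp
  have "sorted_wrt (<) (map (\<lambda>l. ?M (Suc l)) [0..<k])"
    unfolding sorted_wrt_iff_nth_less using mono by (auto simp del: mult_Suc)
  moreover have "set (map (\<lambda>l. ?M (Suc l)) [0..<k]) = minb m ` {S \<in> set C. zero_vec \<notin> S}"
    unfolding labeling_mins[OF lab] by (simp add: atLeast0LessThan)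
  ultimately show ?thesis
    by (metis sorted_list_of_set.idem_if_sorted_distinct strict_sorted_iff)
qed

text \<open>The sorted minima agree, so at position \<open>j\<close> both lists hold a block
  containing the element of the same base and color \<open>j mod m\<close>. Blocks of a partition
  that share an element are equal.\<close>

lemma standard_form_unique:
  assumes C: "standard_form m n k C" and D: "standard_form m n k D" and eq: "set C = set D"
  shows "C = D"
proof -
  have labC: "colored_labeling m n k C" and labD: "colored_labeling m n k D"
    using C D by (auto simp: standard_form_def)
  note C' = labeling_partition[OF labC] and D' = labeling_partition[OF labD]
  have same: "S = S'" if "v \<in> S" "v \<in> S'" "S \<in> set C" "S' \<in> set C" for v S S'
    using disjointD[OF partition_onD2[OF C'(3)], of S S'] that by blast
  have maps: "map (\<lambda>l. minb m (C ! (Suc l * m))) [0..<k] = map (\<lambda>l. minb m (D ! (Suc l * m))) [0..<k]"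
    unfolding standard_form_sorted_mins[OF C] standard_form_sorted_mins[OF D] eq ..
  show ?thesis
  proof (rule nth_equalityI)
    fix j assume "j < length C"
    then have jm: "j \<le> k * m" using C'(1) by simp
    then have "C ! j \<in> set C" "D ! j \<in> set D" using C'(1) D'(1) by simp_all
    then have sets: "C ! j \<in> set C" "D ! j \<in> set C" using eq by simp_all
    show "C ! j = D ! j"
    proof (cases "j = 0")
      case True
      then show ?thesis using same[OF _ _ sets] C'(4) D'(4) by simp
    next
      case False
      then have j: "j \<in> {1..k * m}" using jm by simp
      then have "grp m j \<in> {1..k}" unfolding grp_mem_iff by simp
      then obtain l where l: "grp m j = Suc l" "l < k" by (cases "grp m j") auto
      then have "minb m (C ! j) = minb m (C ! (Suc l * m))" "minb m (D ! j) = minb m (D ! (Suc l * m))"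
        using labeling_minb_group[OF labC j, of "Suc l * m"] labeling_minb_group[OF labD j, of "Suc l * m"]
        by (simp_all del: mult_Suc)
      moreover have "minb m (C ! (Suc l * m)) = minb m (D ! (Suc l * m))"
        using maps l(2) by (simp del: mult_Suc)
      moreover have "colored m (minb m (C ! j)) (j mod m) \<in> C ! j" "colored m (minb m (D ! j)) (j mod m) \<in> D ! j"
        using C D j unfolding standard_form_def by blast+
      ultimately show ?thesis using same[OF _ _ sets] by simp
    qed
  qed (use C'(1) D'(1) in simp)
qed

text \<open>Within a group, multiplication by \<open>zeta m\<close> turns color \<open>i\<close> of
  the minimal base into color \<open>i + 1\<close>, which is the element that marks the block at
  position \<open>i + 1\<close>.\<close>

lemma standard_form_CR_ordered:
  assumes B: "standard_form m n k B"
  shows "B \<in> CR_ordered m n k"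
proof -
  have lab: "colored_labeling m n k B" using B by (simp add: standard_form_def)
  have "B ! (i + 1) = smult_set (zeta m) (B ! i)" if i: "i \<in> {1..<k * m}" "\<not> m dvd i" for i
  proof -
    have i1: "i \<in> {1..k * m}" "i + 1 \<in> {1..k * m}" using i by auto
    obtain l where l: "grp m i = Suc l" using i grp_eq_0_iff[of i] by (cases "grp m i") auto
    then have "l * m < i" "i \<le> Suc l * m" unfolding grp_eq_Suc_iff by auto
    moreover have "i \<noteq> Suc l * m" using i(2) by (metis dvd_triv_right)
    ultimately have "grp m (i + 1) = Suc l" unfolding grp_eq_Suc_iff by linarith
    then have t: "minb m (B ! (i + 1)) = minb m (B ! i)"
      using labeling_minb_group[OF lab i1(1), of "i + 1"] l by simp
    have mem: "colored m (minb m (B ! i)) i \<in> B ! i" "colored m (minb m (B ! i)) (i + 1) \<in> B ! (i + 1)"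
      using B i1 t unfolding standard_form_def by (metis colored_mod)+
    obtain j' where j': "j' \<in> {1..k * m}" "B ! j' = smult_set (zeta m ^ 1) (B ! i)"
      using labeling_smult[OF lab i1(1)] by blast
    have "colored m (minb m (B ! i)) (i + 1) \<in> B ! j'"
      unfolding j'(2) using mem(1) by (intro colored_mem_smult_set_mod[of _ _ i]) simp_all
    then have "j' = i + 1" using labeling_unique[OF lab _ mem(2)] j'(1) i1 by simp
    then show ?thesis using j'(2) by simp
  qed
  then show ?thesis
    using lab labeling_partition[OF lab] unfolding CR_ordered_def colored_partitions_def by blast
qed

section \<open>Transfer of both generating functions to words\<close>

lemma standard_forms_eq: "{B. standard_form m n k B} = blocks n k ` std_words m n k"
proof
  show "{B. standard_form m n k B} \<subseteq> blocks n k ` std_words m n k"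
  proof
    fix B assume "B \<in> {B. standard_form m n k B}"
    then have B: "standard_form m n k B" by simp
    then obtain f where f: "f \<in> words m n k" "B = blocks n k f"
      by (rule CR_ordered_obtain_word[OF standard_form_CR_ordered])
    then show "B \<in> blocks n k ` std_words m n k"
      using standard_form_blocks_iff[OF f(1)] B by blast
  qed
  show "blocks n k ` std_words m n k \<subseteq> {B. standard_form m n k B}"
    using standard_form_blocks_iff by (auto simp: std_words_def)
qed

lemma bij_betw_standard_form:
  "bij_betw set {B. standard_form m n k B} (colored_partitions m n k)"
  unfolding bij_betw_def
proof
  show "inj_on set {B. standard_form m n k B}"
    using standard_form_unique by (auto simp: inj_on_def)
  show "set ` {B. standard_form m n k B} = colored_partitions m n k"
  proof
    show "colored_partitions m n k \<subseteq> set ` {B. standard_form m n k B}"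
      unfolding colored_partitions_def using ex_standard_form by blast
  qed (auto simp: colored_partitions_def standard_form_def)
qed

text \<open>By uniqueness, the definite description in \<open>inv_partition\<close> returns the
  standard form itself. The sum over partitions thus becomes a sum over standard forms and then over
  standard words.\<close>

lemma q_stirling_eq: "q_stirling m n k = (\<Sum>f\<in>std_words m n k. q_var ^ word_inv m n k f)"
proof -
  have "inv_partition m n k (set B) = inv_list m B" if "standard_form m n k B" for B
  proof -
    have "(THE C. standard_form m n k C \<and> set C = set B) = B"
      using that standard_form_unique by (intro the_equality) auto
    then show ?thesis by (simp add: inv_partition_def)
  qed
  moreover have "q_stirling m n k =
      (\<Sum>B | standard_form m n k B. q_var ^ inv_partition m n k (set B))"
    unfolding q_stirling_def by (rule sum.reindex_bij_betw[OF bij_betw_standard_form, symmetric])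
  ultimately have "q_stirling m n k = (\<Sum>B | standard_form m n k B. q_var ^ inv_list m B)"
    by simp
  also have "\<dots> = (\<Sum>f\<in>std_words m n k. q_var ^ inv_list m (blocks n k f))"
    unfolding standard_forms_eq
    by (rule sum.reindex_cong[OF _ refl refl]) (rule inj_on_subset[OF inj_on_blocks], auto simp: std_words_def)
  also have "\<dots> = (\<Sum>f\<in>std_words m n k. q_var ^ word_inv m n k f)"
    by (rule sum.cong) (auto simp: inv_list_blocks std_words_def)
  finally show ?thesis .
qed

lemma sum_CR_ordered_eq:
  "(\<Sum>\<omega>\<in>CR_ordered m n k. q_var ^ inv_list m \<omega>) = (\<Sum>f\<in>words m n k. q_var ^ word_inv m n k f)"
proof -
  have "(\<Sum>\<omega>\<in>CR_ordered m n k. q_var ^ inv_list m \<omega>) =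
      (\<Sum>f\<in>words m n k. q_var ^ inv_list m (blocks n k f))"
    by (rule sum.reindex_bij_betw[OF bij_betw_blocks, symmetric])
  also have "\<dots> = (\<Sum>f\<in>words m n k. q_var ^ word_inv m n k f)"
    by (rule sum.cong) (simp_all add: inv_list_blocks)
  finally show ?thesis .
qed

end

theorem theorem4p9:
  fixes m n k :: nat
  assumes "m \<ge> 1"
  shows "q_stirling_CR m n k = (\<Sum>\<omega>\<in>CR_ordered m n k. q_var ^ inv_list m \<omega>)"
  unfolding q_stirling_CR_def q_stirling_eq[OF assms] sum_CR_ordered_eq[OF assms]
  using sum_words_eq[OF assms] by simp

end
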